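(* (i) There is $c$ such that for all $\epsilon=1/N>0$ and all $t\ge0$, $$\sup_{x_1,x_2\in\Lambda_N:\,|x_1-x_2|=1}\mathbf P_\epsilon[\tau_{x_1,x_2}\ge t]\le\frac{c}{(\epsilon^{-2}t)^{1/2}+1}.$$ (ii) Given any $T>0$, for any $\zeta>0$ and $k\ge1$ there is $c$ such that for all $0<t\le T$ and all $\epsilon=1/N>0$, $$\sup_{x_1,x_2}\mathbf P_\epsilon\big[N_{x_1,x_2,t}\ge(\epsilon^{-2}t)^{1/2+\zeta}\big]\le c(\epsilon^{-2}t)^{-k}.$$
   Context: $\Lambda_N=[-N,N]\cap\mathbb Z$, $\epsilon=1/N$. Active/passive marks process: for each pair $\{x,x+1\}$, $x\in\mathbb Z$, an independent Poisson process of intensity $\epsilon^{-2}$ of "marks", each mark independently "active" or "passive" with probability $1/2$; law $\mathbf P_\epsilon$. Two stirring particles start at distinct sites $x_1,x_2\in\Lambda_N$; when an active mark appears at a pair $\{x,y\}\subset\Lambda_N$ the contents of $x$ and $y$ are exchanged (passive marks and marks at pairs not contained in $\Lambda_N$ have no effect). $x_i(s)$ is the position of particle $i$ at time $s$. $\tau_{x_1,x_2}$ is the first time $s\ge0$ with $|x_1(s)-x_2(s)|=1$ at which a mark (active or passive) appears at the pair $\{x_1(s),x_2(s)\}$. $N_{x_1,x_2,t}$ is the number of times $s\in[0,t]$ such that $|x_1(s)-x_2(s)|=1$ and a mark (active or passive) appears at time $s$ at the pair $\{x_1(s),x_2(s)\}$. *)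

theory Defs
  imports "HOL-Probability.Probability"
begin

text \<open>Sample space of the active/passive marks process.  For each pair index
  x :: int (standing for the pair {x, x+1}) and each n :: nat, the value
  omega (x,n) = (e, b) gives the n-th exponential inter-arrival time e (rate
  eps^-2 = N^2) of the Poisson mark process at pair {x,x+1}, and b = True iff
  the corresponding mark is active (fair coin).  All are independent.\<close>

type_synonym marks = "int \<times> nat \<Rightarrow> real \<times> bool"

definition mark_law :: "nat \<Rightarrow> (real \<times> bool) measure" where
  "mark_law N = density lborel (exponential_density ((real N)\<^sup>2))
                  \<Otimes>\<^sub>M measure_pmf (bernoulli_pmf (1/2))"

definition P_eps :: "nat \<Rightarrow> marks measure" where
  "P_eps N = PiM UNIV (\<lambda>_. mark_law N)"

definition Lambda :: "nat \<Rightarrow> int set" where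
  "Lambda N = {- int N .. int N}"

definition mark_time :: "marks \<Rightarrow> int \<Rightarrow> nat \<Rightarrow> real" where
  "mark_time \<omega> x n = (\<Sum>j\<le>n. fst (\<omega> (x, j)))"

definition inner_pairs :: "nat \<Rightarrow> int set" where
  "inner_pairs N = {x. x \<in> Lambda N \<and> x + 1 \<in> Lambda N}"

definition swp :: "int \<Rightarrow> int \<Rightarrow> int" where
  "swp x y = (if y = x then x + 1 else if y = x + 1 then x else y)"

text \<open>Effect of all marks occurring exactly at time s (inside Lambda_N) on the
  position y of a particle (simultaneous marks happen with probability 0;
  they are processed in increasing order of the pair index).\<close>
definition step :: "marks \<Rightarrow> nat \<Rightarrow> real \<Rightarrow> int \<Rightarrow> int" where
  "step \<omega> N s y = fold
     (\<lambda>x y. if (\<exists>n. mark_time \<omega> x n = s \<and> snd (\<omega> (x, n))) then swp x y else y)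
     (sorted_list_of_set {x \<in> inner_pairs N. \<exists>n. mark_time \<omega> x n = s}) y"

definition times_before :: "marks \<Rightarrow> nat \<Rightarrow> real \<Rightarrow> real set" where
  "times_before \<omega> N s = {mark_time \<omega> x n | x n. x \<in> inner_pairs N \<and> mark_time \<omega> x n < s}"

text \<open>Position at time s (left limit, i.e. just before the marks at time s)
  of the stirring particle started at x0.\<close>
definition pos :: "marks \<Rightarrow> nat \<Rightarrow> int \<Rightarrow> real \<Rightarrow> int" where
  "pos \<omega> N x0 s = fold (step \<omega> N) (sorted_list_of_set (times_before \<omega> N s)) x0"

definition coll_times :: "marks \<Rightarrow> nat \<Rightarrow> int \<Rightarrow> int \<Rightarrow> real set" where
  "coll_times \<omega> N x1 x2 = {s. 0 \<le> s \<and> (\<exists>x n. mark_time \<omega> x n = s \<and>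
       {pos \<omega> N x1 s, pos \<omega> N x2 s} = {x, x + 1})}"

definition tau :: "marks \<Rightarrow> nat \<Rightarrow> int \<Rightarrow> int \<Rightarrow> ereal" where
  "tau \<omega> N x1 x2 = Inf (ereal ` coll_times \<omega> N x1 x2)"

definition Ncoll :: "marks \<Rightarrow> nat \<Rightarrow> int \<Rightarrow> int \<Rightarrow> real \<Rightarrow> nat" where
  "Ncoll \<omega> N x1 x2 t = card {s \<in> coll_times \<omega> N x1 x2. s \<le> t}"

end

theory Submission
  imports Defs
begin

text \<open>
  Both parts estimate \<open>E (q ^ N\<^sub>t)\<close>, where \<open>N\<^sub>t\<close> is the number of collisions up to time \<open>t\<close>: for \<open>q = 0\<close>
  this is the probability that \<open>\<tau>\<close> exceeds \<open>t\<close>, and for \<open>q > 1\<close> it is an exponential moment, to which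
  Markov's inequality applies. By the memoryless property the process starts afresh after the first
  mark in \<open>\<Lambda>\<^sub>N\<close>, so \<open>E (q ^ N\<^sub>t)\<close> solves a renewal equation and is bounded by every supersolution of the
  corresponding Kolmogorov equation for the pair of stirring particles.

  With \<open>D = |x\<^sub>1 - x\<^sub>2|\<close> and \<open>t\<close> fixed, a supersolution for \<open>q = 0\<close> is \<open>1 - s/t + D (2 R - D) / (2 N\<^sup>2 t)\<close> on
  \<open>D \<le> R\<close>, where \<open>R\<close> is of order \<open>N sqrt t\<close>; at \<open>D = 1\<close> and \<open>s = t\<close> it has the required size. Killing the
  pair at rate \<open>N\<^sup>2\<close> when it is adjacent makes \<open>D\<close> a symmetric walk absorbed at \<open>0\<close>, and the walls only push
  \<open>D\<close> downwards, where the function is smaller.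

  For \<open>q = exp \<theta>\<close>, with \<open>a = 1 / (N sqrt t)\<close> and \<open>\<theta>\<close> a small multiple of \<open>a\<close>, a supersolution is
  \<open>exp (2 a\<^sup>2 N\<^sup>2 s) (1 + exp (- a D) + B (\<psi> x\<^sub>1 + \<psi> x\<^sub>2))\<close>: the outward drift of \<open>D\<close> at \<open>D = 1\<close> pays for the
  collisions, and \<open>\<psi> x = exp (a (x - N)) + exp (- a (x + N))\<close> compensates the inward drift at the walls.
\<close>

section \<open>Resampling in infinite product measures\<close>

text \<open>Coordinate \<open>k\<close> is independent of the family reindexed by \<open>f\<close>,
  and injectivity of \<open>f\<close> makes that family i.i.d. with law \<open>M\<close> again. With
  \<open>f = fresh e\<close> this says that deleting the first gap of a pair leaves a fresh copy of
  all marks.\<close>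

lemma nn_integral_PiM_fresh:
  fixes M :: "'a measure" and f :: "'i \<Rightarrow> 'i"
  assumes M: "prob_space M" and f: "inj f" "k \<notin> range f"
    and F[measurable]: "F \<in> borel_measurable (M \<Otimes>\<^sub>M PiM UNIV (\<lambda>_. M))"
  shows "(\<integral>\<^sup>+w. F (w k, \<lambda>i. w (f i)) \<partial>PiM UNIV (\<lambda>_. M)) = (\<integral>\<^sup>+x. \<integral>\<^sup>+w. F (x, w) \<partial>PiM UNIV (\<lambda>_. M) \<partial>M)"
proof -
  interpret M: prob_space M by fact
  let ?P = "PiM UNIV (\<lambda>_. M) :: ('i \<Rightarrow> 'a) measure" and ?P' = "PiM (UNIV - {k}) (\<lambda>_. M) :: ('i \<Rightarrow> 'a) measure"
  interpret P': prob_space ?P' by (intro prob_space_PiM M)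
  have *: "distr (M \<Otimes>\<^sub>M ?P') ?P (\<lambda>(x, X). X(k := x)) = ?P"
    using distr_pair_PiM_eq_PiM[of "UNIV - {k}" "\<lambda>_. M" k] M by (simp add: insert_absorb)
  have **: "distr ?P' ?P (\<lambda>w i. w (f i)) = ?P"
    using distr_PiM_reindex[of "UNIV - {k}" "\<lambda>_. M" f UNIV] M f by (auto simp: restrict_def)
  have m1: "(\<lambda>w i. w (f i)) \<in> ?P \<rightarrow>\<^sub>M ?P"
    by (intro measurable_PiM_single') (auto simp: space_PiM)
  have m2: "(\<lambda>w i. w (f i)) \<in> ?P' \<rightarrow>\<^sub>M ?P"
    using f by (intro measurable_PiM_single') (auto simp: space_PiM PiE_iff intro!: measurable_component_singleton)
  have m3: "(\<lambda>(x, X). X(k := x)) \<in> M \<Otimes>\<^sub>M ?P' \<rightarrow>\<^sub>M ?P"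
    unfolding case_prod_beta by (rule measurable_fun_upd[where J="UNIV - {k}"]) auto
  have m4: "(\<lambda>w. F (w k, \<lambda>i. w (f i))) \<in> borel_measurable ?P"
    by (rule measurable_compose[OF measurable_Pair[OF _ m1] F]) simp
  have "(\<integral>\<^sup>+w. F (w k, \<lambda>i. w (f i)) \<partial>?P)
      = (\<integral>\<^sup>+z. F ((case z of (x, X) \<Rightarrow> X(k := x)) k, \<lambda>i. (case z of (x, X) \<Rightarrow> X(k := x)) (f i)) \<partial>(M \<Otimes>\<^sub>M ?P'))"
    by (subst *[symmetric]) (rule nn_integral_distr[OF m3], use m4 in simp)
  also have "\<dots> = (\<integral>\<^sup>+z. F (fst z, \<lambda>i. snd z (f i)) \<partial>(M \<Otimes>\<^sub>M ?P'))"
  proof (rule nn_integral_cong)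
    fix z :: "'a \<times> ('i \<Rightarrow> 'a)"
    have "(\<lambda>i. ((snd z)(k := fst z)) (f i)) = (\<lambda>i. snd z (f i))" using f(2) by (intro ext) (metis fun_upd_other rangeI)
    then show "F ((case z of (x, X) \<Rightarrow> X(k := x)) k, \<lambda>i. (case z of (x, X) \<Rightarrow> X(k := x)) (f i)) =
         F (fst z, \<lambda>i. snd z (f i))" by (simp add: case_prod_beta)
  qed
  also have "\<dots> = (\<integral>\<^sup>+x. \<integral>\<^sup>+X. F (x, \<lambda>i. X (f i)) \<partial>?P' \<partial>M)"
    using m2 by (subst P'.nn_integral_fst[symmetric]) simp_all
  also have "\<dots> = (\<integral>\<^sup>+x. \<integral>\<^sup>+w. F (x, w) \<partial>?P \<partial>M)"
  proof (rule nn_integral_cong)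
    fix x assume "x \<in> space M"
    then have "(\<lambda>w. F (x, w)) \<in> borel_measurable (distr ?P' ?P (\<lambda>w i. w (f i)))" by simp
    from nn_integral_distr[OF m2 this]
    show "(\<integral>\<^sup>+X. F (x, \<lambda>i. X (f i)) \<partial>?P') = (\<integral>\<^sup>+w. F (x, w) \<partial>?P)" unfolding ** by simp
  qed
  finally show ?thesis .
qed

text \<open>Redrawing one coordinate independently preserves the law: both sides split off
  coordinate \<open>k\<close> from the product over the other indices. Facts about a single gap are
  applied in the inner integral.\<close>

lemma nn_integral_PiM_resample:
  fixes M :: "'a measure" and k :: 'i
  assumes M: "prob_space M"
    and F[measurable]: "F \<in> borel_measurable (PiM UNIV (\<lambda>_. M))"
  shows "(\<integral>\<^sup>+w. F w \<partial>PiM UNIV (\<lambda>_. M)) = (\<integral>\<^sup>+w. \<integral>\<^sup>+x. F (w(k := x)) \<partial>M \<partial>PiM UNIV (\<lambda>_. M))"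
proof -
  interpret M: prob_space M by fact
  let ?P = "PiM UNIV (\<lambda>_. M) :: ('i \<Rightarrow> 'a) measure" and ?P' = "PiM (UNIV - {k}) (\<lambda>_. M) :: ('i \<Rightarrow> 'a) measure"
  interpret P: prob_space ?P by (intro prob_space_PiM M)
  interpret P': prob_space ?P' by (intro prob_space_PiM M)
  interpret pair_sigma_finite M ?P' ..
  have *: "distr (M \<Otimes>\<^sub>M ?P') ?P (\<lambda>(x, X). X(k := x)) = ?P"
    using distr_pair_PiM_eq_PiM[of "UNIV - {k}" "\<lambda>_. M" k] M by (simp add: insert_absorb)
  have **: "distr ?P ?P' (\<lambda>w. \<lambda>n\<in>UNIV - {k}. w n) = ?P'"
    using distr_PiM_reindex[of UNIV "\<lambda>_. M" "\<lambda>x. x" "UNIV - {k}"] M by auto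
  have m3: "(\<lambda>(x, X). X(k := x)) \<in> M \<Otimes>\<^sub>M ?P' \<rightarrow>\<^sub>M ?P"
    unfolding case_prod_beta by (rule measurable_fun_upd[where J="UNIV - {k}"]) auto
  have m4: "(\<lambda>z. F ((snd z)(k := fst z))) \<in> borel_measurable (M \<Otimes>\<^sub>M ?P')"
    using measurable_compose[OF m3 F] by (simp add: case_prod_beta)
  have m5: "(\<lambda>w. \<lambda>n\<in>UNIV - {k}. w n) \<in> ?P \<rightarrow>\<^sub>M ?P'" by measurable
  have "(\<integral>\<^sup>+w. F w \<partial>?P) = (\<integral>\<^sup>+z. F ((snd z)(k := fst z)) \<partial>(M \<Otimes>\<^sub>M ?P'))"
    by (subst *[symmetric], subst nn_integral_distr[OF m3]) (simp_all add: case_prod_beta)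
  also have "\<dots> = (\<integral>\<^sup>+X. \<integral>\<^sup>+x. F (X(k := x)) \<partial>M \<partial>?P')"
    using m4 by (subst nn_integral_snd[symmetric]) (simp_all add: case_prod_beta)
  also have "\<dots> = (\<integral>\<^sup>+w. \<integral>\<^sup>+x. F ((\<lambda>n\<in>UNIV - {k}. w n)(k := x)) \<partial>M \<partial>?P)"
  proof -
    have "(\<lambda>z. F ((fst z)(k := snd z))) \<in> borel_measurable (?P' \<Otimes>\<^sub>M M)"
      using measurable_compose[OF measurable_pair_swap' m4] by (simp add: case_prod_beta)
    then have "(\<lambda>(X,x). F (X(k := x))) \<in> borel_measurable (?P' \<Otimes>\<^sub>M M)" by (simp add: case_prod_beta)
    from M.borel_measurable_nn_integral[OF this]
    have "(\<lambda>X. \<integral>\<^sup>+x. F (X(k := x)) \<partial>M) \<in> borel_measurable (distr ?P ?P' (\<lambda>w. \<lambda>n\<in>UNIV - {k}. w n))" by simp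
    from nn_integral_distr[OF m5 this] show ?thesis unfolding ** .
  qed
  also have "\<dots> = (\<integral>\<^sup>+w. \<integral>\<^sup>+x. F (w(k := x)) \<partial>M \<partial>?P)"
  proof -
    have "(\<lambda>n\<in>UNIV - {k}. w n)(k := x) = w(k := x)" for w :: "'i \<Rightarrow> 'a" and x by auto
    then show ?thesis by simp
  qed
  finally show ?thesis .
qed

text \<open>Fubini for null sets: an almost sure statement about all marks is reduced to one about a
  single gap, the others being frozen.\<close>

lemma AE_PiM_resample:
  fixes M :: "'a measure" and k :: 'i
  assumes M: "prob_space M"
    and Q: "Measurable.pred (PiM UNIV (\<lambda>_. M)) Q"
    and AE: "\<And>w. w \<in> space (PiM UNIV (\<lambda>_. M)) \<Longrightarrow> AE x in M. Q (w(k := x))"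
  shows "AE w in PiM UNIV (\<lambda>_. M). Q w"
proof -
  let ?P = "PiM UNIV (\<lambda>_. M) :: ('i \<Rightarrow> 'a) measure"
  let ?F = "\<lambda>w. indicator {w \<in> space ?P. \<not> Q w} w :: ennreal"
  note [measurable] = Q
  have s: "{w \<in> space ?P. \<not> Q w} \<in> sets ?P" by measurable
  have "emeasure ?P {w \<in> space ?P. \<not> Q w} = (\<integral>\<^sup>+w. ?F w \<partial>?P)" using s by simp
  also have "\<dots> = (\<integral>\<^sup>+w. \<integral>\<^sup>+x. ?F (w(k := x)) \<partial>M \<partial>?P)"
    using s by (intro nn_integral_PiM_resample[OF M]) measurable
  also have "\<dots> = (\<integral>\<^sup>+w. 0 \<partial>?P)"
  proof (rule nn_integral_cong)
    fix w assume w: "w \<in> space ?P"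
    show "(\<integral>\<^sup>+x. ?F (w(k := x)) \<partial>M) = 0"
      using AE[OF w] by (intro nn_integral_zero') (auto elim!: eventually_mono)
  qed
  finally have "{w \<in> space ?P. \<not> Q w} \<in> null_sets ?P" using s by auto
  then show ?thesis by (rule AE_I') auto
qed

section \<open>The law of a single gap and its coin\<close>

lemma space_mark_law [simp]: "space (mark_law N) = UNIV"
  by (simp add: mark_law_def space_pair_measure)

lemma sets_mark_law [measurable_cong]: "sets (mark_law N) = sets (borel \<Otimes>\<^sub>M count_space UNIV)"
  unfolding mark_law_def by (intro sets_pair_measure_cong) auto

lemma space_P_eps [simp]: "space (P_eps N) = UNIV"
  by (simp add: P_eps_def space_PiM)

lemma prob_space_mark_law: "N \<ge> 1 \<Longrightarrow> prob_space (mark_law N)"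
  unfolding mark_law_def
  by (intro prob_space_pair prob_space_exponential_density measure_pmf.prob_space_axioms) simp

lemma prob_space_P_eps: "N \<ge> 1 \<Longrightarrow> prob_space (P_eps N)"
  unfolding P_eps_def by (intro prob_space_PiM prob_space_mark_law)

lemma nn_integral_mark_law:
  assumes F: "F \<in> borel_measurable (borel \<Otimes>\<^sub>M count_space UNIV)"
  shows "(\<integral>\<^sup>+x. F x \<partial>mark_law N)
    = (\<integral>\<^sup>+s. ennreal (exponential_density ((real N)\<^sup>2) s) * ((F (s, True) + F (s, False)) / 2) \<partial>lborel)"
proof -
  let ?B = "measure_pmf (bernoulli_pmf (1/2))" and ?E = "density lborel (exponential_density ((real N)\<^sup>2))"
  have F'[measurable]: "F \<in> borel_measurable (?E \<Otimes>\<^sub>M ?B)"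
  proof -
    have "sets (?E \<Otimes>\<^sub>M ?B) = sets (borel \<Otimes>\<^sub>M count_space UNIV)" by (intro sets_pair_measure_cong) auto
    then show ?thesis using F measurable_cong_sets by blast
  qed
  have Fm: "(\<lambda>s. F (s, b)) \<in> borel_measurable borel" for b
    using measurable_compose[OF _ F, of "\<lambda>s. (s,b)" borel] by simp
  note [measurable] = Fm
  have "(\<integral>\<^sup>+x. F x \<partial>mark_law N) = (\<integral>\<^sup>+s. \<integral>\<^sup>+b. F (s, b) \<partial>?B \<partial>?E)"
    unfolding mark_law_def by (subst measure_pmf.nn_integral_fst[symmetric]) auto
  also have "\<dots> = (\<integral>\<^sup>+s. (F (s, True) + F (s, False)) / 2 \<partial>?E)"
  proof (rule nn_integral_cong)
    fix s
    have e: "ennreal (1/2) = 1 / 2" by (metis divide_ennreal ennreal_1 ennreal_numeral zero_less_numeral zero_le_numeral zero_le_one)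
    show "(\<integral>\<^sup>+b. F (s, b) \<partial>?B) = (F (s, True) + F (s, False)) / 2"
      by (subst nn_integral_bernoulli_pmf) (auto simp: e field_simps divide_ennreal_def distrib_right)
  qed
  also have "\<dots> = (\<integral>\<^sup>+s. ennreal (exponential_density ((real N)\<^sup>2) s) * ((F (s, True) + F (s, False)) / 2) \<partial>lborel)"
    by (subst nn_integral_density) auto
  finally show ?thesis .
qed

section \<open>The process restarted at its first mark\<close>

lemma measurable_gap [measurable]: "(\<lambda>w. fst (w k)) \<in> borel_measurable (P_eps N)"
  and measurable_active [measurable]: "(\<lambda>w. snd (w k)) \<in> P_eps N \<rightarrow>\<^sub>M count_space UNIV"
proof -
  have m: "(\<lambda>w. w k) \<in> P_eps N \<rightarrow>\<^sub>M borel \<Otimes>\<^sub>M count_space UNIV"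
    unfolding P_eps_def measurable_cong_sets[OF refl sets_mark_law[of N, symmetric]]
    by (rule measurable_component_singleton) simp
  show "(\<lambda>w. fst (w k)) \<in> borel_measurable (P_eps N)"
    by (rule measurable_compose[OF m measurable_fst])
  show "(\<lambda>w. snd (w k)) \<in> P_eps N \<rightarrow>\<^sub>M count_space UNIV"
    by (rule measurable_compose[OF m measurable_snd])
qed

lemma measurable_into_P_eps:
  assumes "\<And>k. (\<lambda>x. fst (f x k)) \<in> borel_measurable X" "\<And>k. (\<lambda>x. snd (f x k)) \<in> X \<rightarrow>\<^sub>M count_space UNIV"
  shows "f \<in> X \<rightarrow>\<^sub>M P_eps N"
proof -
  have "(\<lambda>x k. (fst (f x k), snd (f x k))) \<in> X \<rightarrow>\<^sub>M P_eps N"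
    unfolding P_eps_def using assms
    by (intro measurable_PiM_single' measurable_cong_sets[OF refl sets_mark_law, THEN equalityD2, THEN subsetD] measurable_Pair) auto
  then show ?thesis by simp
qed

text \<open>For \<open>v > 0\<close> the exponential density at \<open>s + v\<close> is
  \<open>exp (- (real N)\<^sup>2 * s)\<close> times the density at \<open>v\<close>, and the coin is
  independent of the gap.\<close>

lemma nn_integral_mark_law_memoryless:
  assumes s: "s \<ge> 0" and F: "F \<in> borel_measurable (borel \<Otimes>\<^sub>M count_space UNIV)"
  shows "(\<integral>\<^sup>+x. indicator {s<..} (fst x) * F (fst x - s, snd x) \<partial>mark_law N)
    = ennreal (exp (- (real N)\<^sup>2 * s)) * (\<integral>\<^sup>+x. F x \<partial>mark_law N)"
proof -
  let ?l = "(real N)\<^sup>2"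
  have Fm[measurable]: "(\<lambda>s. F (s, b)) \<in> borel_measurable borel" for b
    using measurable_compose[OF _ F, of "\<lambda>s. (s,b)" borel] by simp
  define H where "H u = (F (u, True) + F (u, False)) / 2" for u
  have Hm[measurable]: "H \<in> borel_measurable borel" unfolding H_def by measurable
  have Gm: "(\<lambda>x. indicator {s<..} (fst x) * F (fst x - s, snd x)) \<in> borel_measurable (borel \<Otimes>\<^sub>M count_space UNIV)"
    using F by measurable
  have "(\<integral>\<^sup>+x. indicator {s<..} (fst x) * F (fst x - s, snd x) \<partial>mark_law N)
     = (\<integral>\<^sup>+u. ennreal (exponential_density ?l u) * (indicator {s<..} u * H (u - s)) \<partial>lborel)"
    by (subst nn_integral_mark_law[OF Gm]) (auto intro!: nn_integral_cong simp: H_def indicator_def)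
  also have "\<dots> = (\<integral>\<^sup>+v. ennreal (exponential_density ?l (s + v)) * (indicator {s<..} (s + v) * H v) \<partial>lborel)"
    by (subst nn_integral_real_affine[where c=1 and t=s]) auto
  also have "\<dots> = (\<integral>\<^sup>+v. ennreal (exp (- ?l * s)) * (ennreal (exponential_density ?l v) * H v) \<partial>lborel)"
  proof (rule nn_integral_cong_AE)
    \<comment> \<open>The point \<open>v = 0\<close> is left out: there the open indicator vanishes
      while the density need not.\<close>
    have ne: "AE v in lborel. v \<noteq> (0::real)" by (rule AE_lborel_singleton)
    show "AE v in lborel. ennreal (exponential_density ?l (s + v)) * (indicator {s<..} (s + v) * H v)
       = ennreal (exp (- ?l * s)) * (ennreal (exponential_density ?l v) * H v)"
      using ne
    proof eventually_elim
      case (elim v)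
      show ?case
      proof (cases "v < 0")
        case True
        then have "s + v \<notin> {s<..}" "exponential_density ?l v = 0" by (auto simp: exponential_density_def)
        then show ?thesis by (simp only: indicator_simps) simp
      next
        case False
        with elim s have "exponential_density ?l (s + v) = exp (- ?l * s) * exponential_density ?l v"
          by (simp add: exponential_density_def exp_add[symmetric] algebra_simps mult_exp_exp)
        then have "ennreal (exponential_density ?l (s + v)) = ennreal (exp (- ?l * s)) * ennreal (exponential_density ?l v)"
          by (simp only: ennreal_mult' exp_ge_zero)
        with False elim show ?thesis by (simp add: mult.assoc)
      qed
    qed
  qed
  also have "\<dots> = ennreal (exp (- ?l * s)) * (\<integral>\<^sup>+x. F x \<partial>mark_law N)"
    by (subst nn_integral_cmult) (auto simp: nn_integral_mark_law[OF F] H_def)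
  finally show ?thesis .
qed

section \<open>Ageing finitely many clocks: memorylessness in the product space\<close>

definition shift :: "(int \<times> nat) set \<Rightarrow> real \<Rightarrow> marks \<Rightarrow> marks" where
  "shift K s w = (\<lambda>k. if k \<in> K then (fst (w k) - s, snd (w k)) else w k)"

lemma measurable_shift [measurable (raw)]:
  assumes [measurable]: "f \<in> borel_measurable X" "g \<in> X \<rightarrow>\<^sub>M P_eps N"
  shows "(\<lambda>x. shift K (f x) (g x)) \<in> X \<rightarrow>\<^sub>M P_eps N"
proof (rule measurable_into_P_eps)
  fix k
  show "(\<lambda>x. fst (shift K (f x) (g x) k)) \<in> borel_measurable X"
    unfolding shift_def by (cases "k \<in> K") auto
  show "(\<lambda>x. snd (shift K (f x) (g x) k)) \<in> X \<rightarrow>\<^sub>M count_space UNIV"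
    unfolding shift_def by (cases "k \<in> K") auto
qed

text \<open>If no clock of \<open>K\<close> has rung by time \<open>s\<close>, the residual gaps are
  distributed like new ones, and each clock contributes one survival factor. The induction on
  \<open>K\<close> redraws one coordinate at a time and uses the one-dimensional memoryless
  property.\<close>

lemma nn_integral_shift:
  assumes N: "N \<ge> 1" and s: "s \<ge> 0" and K: "finite K"
    and G: "G \<in> borel_measurable (P_eps N)"
  shows "(\<integral>\<^sup>+w. indicator {w. \<forall>k\<in>K. s < fst (w k)} w * G (shift K s w) \<partial>P_eps N)
    = ennreal (exp (- (real N)\<^sup>2 * s * card K)) * (\<integral>\<^sup>+w. G w \<partial>P_eps N)"
  using K G
proof (induction K arbitrary: G rule: finite_induct)
  case empty
  then show ?case by (simp add: shift_def)
next
  case (insert k K G)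
  note [measurable] = insert.prems
  note M = prob_space_mark_law[OF N]
  define G2 where "G2 w = indicator {s<..} (fst (w k)) * G (shift {k} s w)" for w
  have G2m[measurable]: "G2 \<in> borel_measurable (P_eps N)"
    unfolding G2_def by measurable
  have e: "indicator {w. \<forall>k\<in>insert k K. s < fst (w k)} w * G (shift (insert k K) s w)
    = indicator {w. \<forall>k\<in>K. s < fst (w k)} w * G2 (shift K s w)" for w
  proof -
    have "shift (insert k K) s w = shift {k} s (shift K s w)" "fst (shift K s w k) = fst (w k)"
      using insert.hyps by (auto simp: shift_def)
    then show ?thesis by (auto simp: G2_def indicator_def)
  qed
  have Gup: "(\<lambda>x. G (w(k := x))) \<in> borel_measurable (borel \<Otimes>\<^sub>M count_space UNIV)" for w
  proof -
    have "(\<lambda>x. w(k := x)) \<in> borel \<Otimes>\<^sub>M count_space UNIV \<rightarrow>\<^sub>M P_eps N"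
    proof (rule measurable_into_P_eps)
      fix j show "(\<lambda>x. fst ((w(k := x)) j)) \<in> borel_measurable (borel \<Otimes>\<^sub>M count_space UNIV)"
        by (cases "j = k") auto
      show "(\<lambda>x. snd ((w(k := x)) j)) \<in> borel \<Otimes>\<^sub>M count_space UNIV \<rightarrow>\<^sub>M count_space UNIV"
        by (cases "j = k") auto
    qed
    then show ?thesis by (rule measurable_compose) fact
  qed
  have "(\<integral>\<^sup>+w. G2 w \<partial>P_eps N) = (\<integral>\<^sup>+w. \<integral>\<^sup>+x. G2 (w(k := x)) \<partial>mark_law N \<partial>P_eps N)"
    using G2m unfolding P_eps_def by (rule nn_integral_PiM_resample[OF M])
  also have "\<dots> = (\<integral>\<^sup>+w. \<integral>\<^sup>+x. indicator {s<..} (fst x) * G (w(k := (fst x - s, snd x))) \<partial>mark_law N \<partial>P_eps N)"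
  proof (intro nn_integral_cong)
    fix w :: marks and x :: "real \<times> bool"
    have "shift {k} s (w(k := x)) = w(k := (fst x - s, snd x))" by (auto simp: shift_def)
    then show "G2 (w(k := x)) = indicator {s<..} (fst x) * G (w(k := (fst x - s, snd x)))" by (simp add: G2_def)
  qed
  also have "\<dots> = (\<integral>\<^sup>+w. ennreal (exp (- (real N)\<^sup>2 * s)) * (\<integral>\<^sup>+x. G (w(k := x)) \<partial>mark_law N) \<partial>P_eps N)"
    using nn_integral_mark_law_memoryless[OF s Gup] by (intro nn_integral_cong) simp
  also have "\<dots> = ennreal (exp (- (real N)\<^sup>2 * s)) * (\<integral>\<^sup>+w. \<integral>\<^sup>+x. G (w(k := x)) \<partial>mark_law N \<partial>P_eps N)"
  proof (rule nn_integral_cmult)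
    interpret M: prob_space "mark_law N" by fact
    have "(\<lambda>z. (fst z)(k := snd z)) \<in> P_eps N \<Otimes>\<^sub>M mark_law N \<rightarrow>\<^sub>M P_eps N"
      unfolding P_eps_def by (rule measurable_fun_upd[where J=UNIV]) auto
    then have "(\<lambda>z. G ((fst z)(k := snd z))) \<in> borel_measurable (P_eps N \<Otimes>\<^sub>M mark_law N)"
      by (rule measurable_compose) fact
    then show "(\<lambda>w. \<integral>\<^sup>+x. G (w(k := x)) \<partial>mark_law N) \<in> borel_measurable (P_eps N)"
      using M.borel_measurable_nn_integral[of "\<lambda>w x. G (w(k := x))" "P_eps N"] by (simp add: case_prod_beta)
  qed
  also have "(\<integral>\<^sup>+w. \<integral>\<^sup>+x. G (w(k := x)) \<partial>mark_law N \<partial>P_eps N) = (\<integral>\<^sup>+w. G w \<partial>P_eps N)"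
    using insert.prems unfolding P_eps_def by (rule nn_integral_PiM_resample[OF M, symmetric])
  finally have G2i: "(\<integral>\<^sup>+w. G2 w \<partial>P_eps N) = ennreal (exp (- (real N)\<^sup>2 * s)) * (\<integral>\<^sup>+w. G w \<partial>P_eps N)" .
  show ?case
  proof -
    have "exp (- (real N)\<^sup>2 * s * card (insert k K)) = exp (- (real N)\<^sup>2 * s * card K) * exp (- (real N)\<^sup>2 * s)"
      using insert.hyps by (simp add: algebra_simps flip: exp_add)
    then have "ennreal (exp (- (real N)\<^sup>2 * s * card (insert k K)))
        = ennreal (exp (- (real N)\<^sup>2 * s * card K)) * ennreal (exp (- (real N)\<^sup>2 * s))"
      by (simp only: ennreal_mult' exp_ge_zero)
    then show ?thesis unfolding e insert.IH[OF G2m] G2i by (simp only: mult.assoc)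
  qed
qed

section \<open>The first mark and the configuration seen from it\<close>

definition fresh :: "int \<Rightarrow> int \<times> nat \<Rightarrow> int \<times> nat" where
  "fresh e k = (if fst k = e then (e, Suc (snd k)) else k)"

text \<open>The strict inequality makes these events disjoint for distinct \<open>e\<close> in
  \<open>E\<close>, so a sum over \<open>e\<close> picks out the pair that rings first.\<close>

definition first_mark :: "int set \<Rightarrow> int \<Rightarrow> marks \<Rightarrow> bool" where
  "first_mark E e w \<longleftrightarrow> (\<forall>x\<in>E - {e}. fst (w (e, 0)) < fst (w (x, 0)))"

text \<open>All marks as seen from the first one: at \<open>e\<close> the first gap has been
  consumed, at the other pairs of \<open>E\<close> only its residual part remains. Pairs outside
  \<open>E\<close> are not aged; with \<open>E = inner_pairs N\<close> their marks never move a
  particle.\<close>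

definition restart :: "int set \<Rightarrow> int \<Rightarrow> marks \<Rightarrow> marks" where
  "restart E e w = shift ((\<lambda>x. (x, 0)) ` (E - {e})) (fst (w (e, 0))) (\<lambda>k. w (fresh e k))"

lemma measurable_restart [measurable]: "restart E e \<in> P_eps N \<rightarrow>\<^sub>M P_eps N"
proof -
  have [measurable]: "(\<lambda>w k. w (fresh e k)) \<in> P_eps N \<rightarrow>\<^sub>M P_eps N"
    by (rule measurable_into_P_eps) measurable
  show ?thesis unfolding restart_def by measurable
qed

lemma measurable_first_mark [measurable]:
  assumes "finite E" shows "Measurable.pred (P_eps N) (first_mark E e)"
proof -
  have "finite (E - {e})" using assms by simp
  then show ?thesis unfolding first_mark_def by measurable
qed

text \<open>Strong Markov property at the first mark. The density of the gap at \<open>e\<close> and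
  the survival of the other \<open>card E - 1\<close> clocks until \<open>s\<close> combine into the
  exponential; given both, the coin is fair and the restarted marks have law
  \<open>P_eps N\<close>.\<close>

lemma nn_integral_first_mark:
  assumes N: "N \<ge> 1" and E: "finite E" "e \<in> E"
    and F: "F \<in> borel_measurable (borel \<Otimes>\<^sub>M (count_space UNIV \<Otimes>\<^sub>M P_eps N))"
  shows "(\<integral>\<^sup>+w. indicator {w. first_mark E e w} w * F (fst (w (e, 0)), snd (w (e, 0)), restart E e w) \<partial>P_eps N)
    = (\<integral>\<^sup>+s. indicator {0..} s * ennreal ((real N)\<^sup>2 * exp (- (real N)\<^sup>2 * card E * s))
        * (((\<integral>\<^sup>+w. F (s, True, w) \<partial>P_eps N) + (\<integral>\<^sup>+w. F (s, False, w) \<partial>P_eps N)) / 2) \<partial>lborel)"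
proof -
  let ?l = "(real N)\<^sup>2" and ?P = "P_eps N" and ?K = "(\<lambda>x. (x, 0::nat)) ` (E - {e})"
  note M = prob_space_mark_law[OF N]
  interpret P: prob_space ?P by (rule prob_space_P_eps[OF N])
  note [measurable] = F
  have K: "finite ?K" "card ?K = card E - 1" using E by (auto simp: card_image inj_on_def)
  define F1 where "F1 z = indicator {w. \<forall>k\<in>?K. fst (fst z) < fst (w k)} (snd z)
      * F (fst (fst z), snd (fst z), shift ?K (fst (fst z)) (snd z))" for z :: "(real \<times> bool) \<times> marks"
  have m: "mark_law N \<Otimes>\<^sub>M ?P \<rightarrow>\<^sub>M borel = (borel \<Otimes>\<^sub>M count_space UNIV) \<Otimes>\<^sub>M ?P \<rightarrow>\<^sub>M borel"
    by (intro measurable_cong_sets sets_pair_measure_cong sets_mark_law) auto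
  have F1m0: "F1 \<in> borel_measurable ((borel \<Otimes>\<^sub>M count_space UNIV) \<Otimes>\<^sub>M ?P)"
    unfolding F1_def using K(1) by measurable
  then have F1m: "F1 \<in> borel_measurable (mark_law N \<Otimes>\<^sub>M ?P)" unfolding m .
  have inj: "inj (fresh e)" "(e, 0) \<notin> range (fresh e)"
    by (auto simp: inj_def fresh_def split: if_splits)
  have "(\<integral>\<^sup>+w. indicator {w. first_mark E e w} w * F (fst (w (e, 0)), snd (w (e, 0)), restart E e w) \<partial>?P)
     = (\<integral>\<^sup>+w. F1 (w (e, 0), \<lambda>k. w (fresh e k)) \<partial>?P)"
    by (intro nn_integral_cong) (auto simp: F1_def restart_def first_mark_def fresh_def indicator_def)
  also have "\<dots> = (\<integral>\<^sup>+x. \<integral>\<^sup>+w. F1 (x, w) \<partial>?P \<partial>mark_law N)"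
    using F1m unfolding P_eps_def by (rule nn_integral_PiM_fresh[OF M inj])
  also have "\<dots> = (\<integral>\<^sup>+s. ennreal (exponential_density ?l s) * (((\<integral>\<^sup>+w. F1 ((s, True), w) \<partial>?P) + (\<integral>\<^sup>+w. F1 ((s, False), w) \<partial>?P)) / 2) \<partial>lborel)"
    using P.borel_measurable_nn_integral[of "\<lambda>x w. F1 (x, w)" "borel \<Otimes>\<^sub>M count_space UNIV"] F1m0
    by (intro nn_integral_mark_law) simp
  also have "\<dots> = (\<integral>\<^sup>+s. indicator {0..} s * ennreal (?l * exp (- ?l * card E * s))
        * (((\<integral>\<^sup>+w. F (s, True, w) \<partial>?P) + (\<integral>\<^sup>+w. F (s, False, w) \<partial>?P)) / 2) \<partial>lborel)"
  proof (rule nn_integral_cong)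
    fix s :: real
    show "ennreal (exponential_density ?l s) * (((\<integral>\<^sup>+w. F1 ((s, True), w) \<partial>?P) + (\<integral>\<^sup>+w. F1 ((s, False), w) \<partial>?P)) / 2)
      = indicator {0..} s * ennreal (?l * exp (- ?l * card E * s))
        * (((\<integral>\<^sup>+w. F (s, True, w) \<partial>?P) + (\<integral>\<^sup>+w. F (s, False, w) \<partial>?P)) / 2)"
    proof (cases "s < 0")
      case True then show ?thesis by (simp add: exponential_density_def)
    next
      case False
      have Fb: "(\<integral>\<^sup>+w. F1 ((s, b), w) \<partial>?P) = ennreal (exp (- ?l * s * (card E - 1))) * (\<integral>\<^sup>+w. F (s, b, w) \<partial>?P)" for b
        using nn_integral_shift[OF N, of s ?K "\<lambda>w. F (s, b, w)"] False K unfolding F1_def by simp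
      have alg: "x * ((y * a + y * b) / 2) = (x * y) * ((a + b) / 2)" for x y a b :: ennreal
        by (simp add: divide_ennreal_def distrib_left distrib_right mult_ac)
      \<comment> \<open>Since \<open>e\<close> lies in \<open>E\<close>, the natural number
        subtraction \<open>card E - 1\<close> is not truncated.\<close>
      have c: "real (card E) = 1 + real (card E - 1)"
        using E by (metis One_nat_def Suc_pred card_gt_0_iff empty_iff of_nat_Suc)
      have ee: "exponential_density ?l s * exp (- ?l * s * (card E - 1)) = ?l * exp (- ?l * card E * s)"
        using False unfolding c by (simp add: exponential_density_def algebra_simps mult_exp_exp)
      have "ennreal (exponential_density ?l s) * (((\<integral>\<^sup>+w. F1 ((s, True), w) \<partial>?P) + (\<integral>\<^sup>+w. F1 ((s, False), w) \<partial>?P)) / 2)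
        = (ennreal (exponential_density ?l s) * ennreal (exp (- ?l * s * (card E - 1)))) * (((\<integral>\<^sup>+w. F (s, True, w) \<partial>?P) + (\<integral>\<^sup>+w. F (s, False, w) \<partial>?P)) / 2)"
        unfolding Fb by (rule alg)
      also have "ennreal (exponential_density ?l s) * ennreal (exp (- ?l * s * (card E - 1))) = ennreal (?l * exp (- ?l * card E * s))"
        unfolding ee[symmetric] by (rule ennreal_mult''[symmetric]) simp
      finally show ?thesis using False by simp
    qed
  qed
  finally show ?thesis .
qed

section \<open>The renewal equation and supersolutions\<close>

text \<open>The coin does not enter, because active and passive marks both count as
  collisions.\<close>

definition coll_weight :: "real \<Rightarrow> int \<Rightarrow> int \<Rightarrow> int \<Rightarrow> real" where
  "coll_weight q e x y = (if {x, y} = {e, e + 1} then q else 1)"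

definition move :: "int \<Rightarrow> bool \<Rightarrow> int \<Rightarrow> int" where
  "move e b x = (if b then swp e x else x)"

text \<open>For \<open>E = inner_pairs N\<close> this is \<open>q ^ Ncoll\<close> up to time
  \<open>t\<close>, restricted to configurations with fewer than \<open>n\<close> marks in that
  time, written as a recursion over the first mark. The cutoff makes the recursion terminate and
  lets every estimate start from 0.\<close>

primrec weight :: "real \<Rightarrow> int set \<Rightarrow> nat \<Rightarrow> real \<Rightarrow> int \<Rightarrow> int \<Rightarrow> marks \<Rightarrow> ennreal" where
  "weight q E 0 t x y w = 0"
| "weight q E (Suc n) t x y w =
    indicator {w. \<forall>k\<in>(\<lambda>e. (e, 0)) ` E. t < fst (w k)} w +
    (\<Sum>e\<in>E. indicator {w. first_mark E e w} w *
      (indicator {..t} (fst (w (e, 0))) * (ennreal (coll_weight q e x y) *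
       weight q E n (t - fst (w (e, 0))) (move e (snd (w (e, 0))) x) (move e (snd (w (e, 0))) y) (restart E e w))))"

text \<open>Stated for varying time and marks because the recursive call runs with a random
  remaining time and with restarted marks.\<close>

lemma measurable_weight [measurable (raw)]:
  assumes "finite E" "f \<in> borel_measurable X" "g \<in> X \<rightarrow>\<^sub>M P_eps N"
  shows "(\<lambda>z. weight q E n (f z) x y (g z)) \<in> borel_measurable X"
  using assms(2,3)
proof (induction n arbitrary: x y X f g)
  case 0
  then show ?case by simp
next
  case (Suc n)
  note [measurable] = Suc.prems
  have E: "finite ((\<lambda>e. (e, 0::nat)) ` E)" using assms(1) by simp
  have 1: "(\<lambda>z. indicator {w. \<forall>k\<in>(\<lambda>e. (e, 0)) ` E. f z < fst (w k)} (g z) :: ennreal) \<in> borel_measurable X"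
    using E by measurable
  have 2: "(\<lambda>z. weight q E n (f z - fst (g z (e, 0))) (move e (snd (g z (e, 0))) x)
      (move e (snd (g z (e, 0))) y) (restart E e (g z))) \<in> borel_measurable X" for e
  proof -
    have [measurable]: "(\<lambda>z. weight q E n (f z - fst (g z (e, 0))) x' y' (restart E e (g z))) \<in> borel_measurable X" for x' y'
      by (rule Suc.IH) measurable
    \<comment> \<open>The positions after the mark depend on the coin alone; in each of its two
      branches they are constants, as the induction hypothesis requires.\<close>
    have "(\<lambda>z. if snd (g z (e, 0)) then weight q E n (f z - fst (g z (e, 0))) (swp e x) (swp e y) (restart E e (g z))
        else weight q E n (f z - fst (g z (e, 0))) x y (restart E e (g z))) \<in> borel_measurable X"
      by measurable
    then show ?thesis
      by (rule measurable_cong[THEN iffD1, rotated]) (simp add: move_def)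
  qed
  have 3: "(\<lambda>z. indicator {w. first_mark E e w} (g z) :: ennreal) \<in> borel_measurable X" for e
    using measurable_compose[OF Suc.prems(2) measurable_first_mark[OF assms(1)]] by measurable
  have 4: "(\<lambda>z. indicator {..f z} (fst (g z (e, 0))) :: ennreal) \<in> borel_measurable X" for e
  proof -
    have "(\<lambda>z. if fst (g z (e, 0)) \<le> f z then 1 else 0 :: ennreal) \<in> borel_measurable X" by measurable
    then show ?thesis by (rule measurable_cong[THEN iffD1, rotated]) simp
  qed
  note [measurable] = 1 2 3 4
  show ?case unfolding weight.simps by measurable
qed

text \<open>Renewal equation: either there is no mark up to \<open>t\<close>, or the first one
  contributes its collision weight and restarts the process, with or without the swap at equal
  odds.\<close>

lemma nn_integral_weight_Suc:
  assumes N: "N \<ge> 1" and E: "finite E" and t: "t \<ge> 0" and q: "q \<ge> 0"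
  defines "L \<equiv> (real N)\<^sup>2 * card E" and "u \<equiv> \<lambda>n t x y. \<integral>\<^sup>+w. weight q E n t x y w \<partial>P_eps N"
  shows "(\<integral>\<^sup>+w. weight q E (Suc n) t x y w \<partial>P_eps N) = ennreal (exp (- L * t)) +
    (\<integral>\<^sup>+s. (\<Sum>e\<in>E. indicator {0..t} s * ennreal ((real N)\<^sup>2 * exp (- L * s)) * ennreal (coll_weight q e x y) *
      ((u n (t - s) (swp e x) (swp e y) + u n (t - s) x y) / 2)) \<partial>lborel)"
proof -
  let ?P = "P_eps N"
  interpret P: prob_space ?P by (rule prob_space_P_eps[OF N])
  have finK: "finite ((\<lambda>e. (e, 0::nat)) ` E)" and cK: "card ((\<lambda>e. (e, 0::nat)) ` E) = card E"
    using E by (auto simp: card_image inj_on_def)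
  have um[measurable]: "(\<lambda>s. u n (t - s) x y) \<in> borel_measurable lborel" for x y
    unfolding u_def using E by (intro P.borel_measurable_nn_integral) (simp add: case_prod_beta)
  have m1: "(\<lambda>w. indicator {w. \<forall>k\<in>(\<lambda>e. (e, 0)) ` E. t < fst (w k)} w :: ennreal) \<in> borel_measurable ?P"
    using finK by measurable
  define F where "F e z = indicator {..t} (fst z) * (ennreal (coll_weight q e x y) *
      weight q E n (t - fst z) (move e (fst (snd z)) x) (move e (fst (snd z)) y) (snd (snd z)))" for e and z :: "real \<times> bool \<times> marks"
  have Fm: "F e \<in> borel_measurable (borel \<Otimes>\<^sub>M (count_space UNIV \<Otimes>\<^sub>M ?P))" for e
  proof -
    let ?X = "borel \<Otimes>\<^sub>M (count_space UNIV \<Otimes>\<^sub>M ?P) :: (real \<times> bool \<times> marks) measure"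
    have [measurable]: "(\<lambda>z. weight q E n (t - fst z) x' y' (snd (snd z))) \<in> borel_measurable ?X" for x' y'
      using E by measurable
    have "(\<lambda>z. if fst (snd z) then weight q E n (t - fst z) (swp e x) (swp e y) (snd (snd z))
        else weight q E n (t - fst z) x y (snd (snd z))) \<in> borel_measurable ?X"
      by measurable
    then have [measurable]: "(\<lambda>z. weight q E n (t - fst z) (move e (fst (snd z)) x) (move e (fst (snd z)) y) (snd (snd z))) \<in> borel_measurable ?X"
      by (rule measurable_cong[THEN iffD1, rotated]) (simp add: move_def)
    show ?thesis unfolding F_def by measurable
  qed
  have m2: "(\<lambda>w. indicator {w. first_mark E e w} w * F e (fst (w (e, 0)), snd (w (e, 0)), restart E e w)) \<in> borel_measurable ?P" for e
  proof -
    have "(\<lambda>w. (fst (w (e, 0)), snd (w (e, 0)), restart E e w)) \<in> ?P \<rightarrow>\<^sub>M borel \<Otimes>\<^sub>M (count_space UNIV \<Otimes>\<^sub>M ?P)"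
      by measurable
    from measurable_compose[OF this Fm] measurable_first_mark[OF E] show ?thesis by measurable
  qed
  have "(\<integral>\<^sup>+w. weight q E (Suc n) t x y w \<partial>?P)
    = (\<integral>\<^sup>+w. indicator {w. \<forall>k\<in>(\<lambda>e. (e, 0)) ` E. t < fst (w k)} w +
      (\<Sum>e\<in>E. indicator {w. first_mark E e w} w * F e (fst (w (e, 0)), snd (w (e, 0)), restart E e w)) \<partial>?P)"
    by (simp add: F_def)
  also have "\<dots> = (\<integral>\<^sup>+w. indicator {w. \<forall>k\<in>(\<lambda>e. (e, 0)) ` E. t < fst (w k)} w \<partial>?P) +
      (\<Sum>e\<in>E. \<integral>\<^sup>+w. indicator {w. first_mark E e w} w * F e (fst (w (e, 0)), snd (w (e, 0)), restart E e w) \<partial>?P)"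
    using m1 m2 by (subst nn_integral_add) (auto simp: nn_integral_sum)
  also have "(\<integral>\<^sup>+w. indicator {w. \<forall>k\<in>(\<lambda>e. (e, 0)) ` E. t < fst (w k)} w \<partial>?P) = ennreal (exp (- L * t))"
    using nn_integral_shift[OF N t finK, of "\<lambda>_. 1"] P.emeasure_space_1 by (simp add: cK L_def algebra_simps)
  also have "(\<Sum>e\<in>E. \<integral>\<^sup>+w. indicator {w. first_mark E e w} w * F e (fst (w (e, 0)), snd (w (e, 0)), restart E e w) \<partial>?P)
    = (\<Sum>e\<in>E. \<integral>\<^sup>+s. indicator {0..t} s * ennreal ((real N)\<^sup>2 * exp (- L * s)) * ennreal (coll_weight q e x y) *
      ((u n (t - s) (swp e x) (swp e y) + u n (t - s) x y) / 2) \<partial>lborel)"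
  proof (intro sum.cong refl)
    fix e assume e: "e \<in> E"
    have uF: "(\<integral>\<^sup>+w. F e (s, b, w) \<partial>?P) = indicator {..t} s * (ennreal (coll_weight q e x y) * u n (t - s) (move e b x) (move e b y))" for s b
      using E unfolding F_def u_def by (simp add: nn_integral_cmult)
    have alg: "a * b * ((c * (d * x) + c * (d * y)) / 2) = a * c * b * d * ((x + y) / 2)" for a b c d x y :: ennreal
      by (simp add: divide_ennreal_def distrib_left distrib_right mult_ac)
    have ind: "indicator {0..} s * indicator {..t} s = (indicator {0..t} s :: ennreal)" for s :: real
      by (auto simp: indicator_def)
    show "(\<integral>\<^sup>+w. indicator {w. first_mark E e w} w * F e (fst (w (e, 0)), snd (w (e, 0)), restart E e w) \<partial>?P)
     = (\<integral>\<^sup>+s. indicator {0..t} s * ennreal ((real N)\<^sup>2 * exp (- L * s)) * ennreal (coll_weight q e x y) *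
      ((u n (t - s) (swp e x) (swp e y) + u n (t - s) x y) / 2) \<partial>lborel)"
      unfolding nn_integral_first_mark[OF N E e Fm] uF alg ind by (simp add: move_def L_def)
  qed
  also have "\<dots> = (\<integral>\<^sup>+s. (\<Sum>e\<in>E. indicator {0..t} s * ennreal ((real N)\<^sup>2 * exp (- L * s)) * ennreal (coll_weight q e x y) *
      ((u n (t - s) (swp e x) (swp e y) + u n (t - s) x y) / 2)) \<partial>lborel)"
    by (rule nn_integral_sum[symmetric]) measurable
  finally show ?thesis .
qed

text \<open>Comparison principle, one step of the iteration. By \<open>super\<close> the renewal
  integrand is at most the \<open>s\<close>-derivative of
  \<open>- exp (- L * s) * g (t - s) x y\<close>, where \<open>L\<close> is the total mark rate; the
  integral telescopes and \<open>g1\<close> absorbs the no-mark term. The hypotheses speak only of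
  \<open>(x, y)\<close>, its neighbours and times up to \<open>t\<close>, so \<open>g\<close> may be
  a supersolution on part of the state space.\<close>

lemma nn_integral_weight_Suc_le:
  assumes N: "N \<ge> 1" and E: "finite E" and t: "t \<ge> 0" and q: "q \<ge> 0"
  assumes le: "\<And>s. 0 \<le> s \<Longrightarrow> s \<le> t \<Longrightarrow> (\<integral>\<^sup>+w. weight q E n s x y w \<partial>P_eps N) \<le> ennreal (g s x y)"
    and le': "\<And>s e. 0 \<le> s \<Longrightarrow> s \<le> t \<Longrightarrow> e \<in> E \<Longrightarrow>
      (\<integral>\<^sup>+w. weight q E n s (swp e x) (swp e y) w \<partial>P_eps N) \<le> ennreal (g s (swp e x) (swp e y))"
    and g0: "\<And>s. 0 \<le> s \<Longrightarrow> s \<le> t \<Longrightarrow> 0 \<le> g s x y"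
    and g0': "\<And>s e. 0 \<le> s \<Longrightarrow> s \<le> t \<Longrightarrow> e \<in> E \<Longrightarrow> 0 \<le> g s (swp e x) (swp e y)"
    and g1: "1 \<le> g 0 x y"
    and d: "\<And>s. ((\<lambda>s. g s x y) has_real_derivative g' s) (at s)"
    and c: "continuous_on UNIV g'"
    and super: "\<And>s. 0 \<le> s \<Longrightarrow> s \<le> t \<Longrightarrow>
      (real N)\<^sup>2 * (\<Sum>e\<in>E. coll_weight q e x y * (g s (swp e x) (swp e y) + g s x y) / 2)
        \<le> (real N)\<^sup>2 * card E * g s x y + g' s"
  shows "(\<integral>\<^sup>+w. weight q E (Suc n) t x y w \<partial>P_eps N) \<le> ennreal (g t x y)"
proof -
  define L where "L = (real N)\<^sup>2 * card E"
  let ?u = "\<lambda>t x y. \<integral>\<^sup>+w. weight q E n t x y w \<partial>P_eps N"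
  define h where "h s = exp (- L * s) * (L * g (t - s) x y + g' (t - s))" for s
  have cw: "coll_weight q e x y \<ge> 0" for e using q by (simp add: coll_weight_def)
  have cg: "continuous_on UNIV (\<lambda>s. g s x y)"
    using d by (meson DERIV_continuous_on has_field_derivative_at_within)
  have hm: "h \<in> borel_measurable borel"
    unfolding h_def
    by (intro borel_measurable_continuous_onI continuous_intros continuous_on_compose2[OF cg] continuous_on_compose2[OF c]) auto
  have half: "(ennreal a + ennreal b) / 2 = ennreal ((a + b) / 2)" if "a \<ge> 0" "b \<ge> 0" for a b
    using that by (metis add_nonneg_nonneg divide_ennreal ennreal_numeral ennreal_plus zero_less_numeral zero_le_numeral)
  have pt: "(\<Sum>e\<in>E. indicator {0..t} s * ennreal ((real N)\<^sup>2 * exp (- L * s)) * ennreal (coll_weight q e x y) *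
      ((?u (t - s) (swp e x) (swp e y) + ?u (t - s) x y) / 2)) \<le> ennreal (h s) * indicator {0..t} s"
    and h0: "s \<in> {0..t} \<Longrightarrow> h s \<ge> 0" for s
  proof -
    have *: "(\<Sum>e\<in>E. ennreal ((real N)\<^sup>2 * exp (- L * s)) * ennreal (coll_weight q e x y) *
      ((?u (t - s) (swp e x) (swp e y) + ?u (t - s) x y) / 2)) \<le> ennreal (h s) \<and> h s \<ge> 0" if s: "s \<in> {0..t}"
    proof -
      have ts: "0 \<le> t - s" "t - s \<le> t" using s by auto
      let ?r = "\<lambda>e. (real N)\<^sup>2 * exp (- L * s) * (coll_weight q e x y * (g (t - s) (swp e x) (swp e y) + g (t - s) x y) / 2)"
      have r0: "e \<in> E \<Longrightarrow> ?r e \<ge> 0" for e using cw[of e] g0[OF ts] g0'[OF ts, of e] by simp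
      have "(\<Sum>e\<in>E. ennreal ((real N)\<^sup>2 * exp (- L * s)) * ennreal (coll_weight q e x y) *
        ((?u (t - s) (swp e x) (swp e y) + ?u (t - s) x y) / 2)) \<le> (\<Sum>e\<in>E. ennreal (?r e))"
      proof (rule sum_mono)
        fix e assume e: "e \<in> E"
        have "((?u (t - s) (swp e x) (swp e y) + ?u (t - s) x y) / 2)
           \<le> (ennreal (g (t - s) (swp e x) (swp e y)) + ennreal (g (t - s) x y)) / 2"
          by (intro divide_right_mono_ennreal add_mono le'[OF ts e] le[OF ts])
        also have "\<dots> = ennreal ((g (t - s) (swp e x) (swp e y) + g (t - s) x y) / 2)"
          using g0[OF ts] g0'[OF ts e] by (intro half)
        finally have "ennreal ((real N)\<^sup>2 * exp (- L * s)) * ennreal (coll_weight q e x y) *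
          ((?u (t - s) (swp e x) (swp e y) + ?u (t - s) x y) / 2) \<le> ennreal ((real N)\<^sup>2 * exp (- L * s)) * ennreal (coll_weight q e x y) *
          ennreal ((g (t - s) (swp e x) (swp e y) + g (t - s) x y) / 2)" by (rule mult_left_mono) simp
        also have "\<dots> = ennreal (?r e)"
          using cw[of e] g0[OF ts] g0'[OF ts e] by (simp add: ennreal_mult'[symmetric] mult_ac)
        finally show "ennreal ((real N)\<^sup>2 * exp (- L * s)) * ennreal (coll_weight q e x y) *
          ((?u (t - s) (swp e x) (swp e y) + ?u (t - s) x y) / 2) \<le> ennreal (?r e)" .
      qed
      also have "\<dots> = ennreal (sum ?r E)" using r0 by (simp add: sum_ennreal)
      finally have 1: "(\<Sum>e\<in>E. ennreal ((real N)\<^sup>2 * exp (- L * s)) * ennreal (coll_weight q e x y) *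
        ((?u (t - s) (swp e x) (swp e y) + ?u (t - s) x y) / 2)) \<le> ennreal (sum ?r E)" .
      have "sum ?r E = exp (- L * s) * ((real N)\<^sup>2 * (\<Sum>e\<in>E. coll_weight q e x y * (g (t - s) (swp e x) (swp e y) + g (t - s) x y) / 2))"
        by (simp add: sum_distrib_left mult_ac)
      also have "\<dots> \<le> h s" unfolding h_def L_def using super[OF ts] by (intro mult_left_mono) auto
      finally have 2: "sum ?r E \<le> h s" .
      have "0 \<le> sum ?r E" using r0 by (rule sum_nonneg)
      with 1 2 show ?thesis by (meson ennreal_leI order_trans)
    qed
    show "(\<Sum>e\<in>E. indicator {0..t} s * ennreal ((real N)\<^sup>2 * exp (- L * s)) * ennreal (coll_weight q e x y) *
      ((?u (t - s) (swp e x) (swp e y) + ?u (t - s) x y) / 2)) \<le> ennreal (h s) * indicator {0..t} s"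
      using * by (cases "s \<in> {0..t}") auto
    show "s \<in> {0..t} \<Longrightarrow> h s \<ge> 0" using * by blast
  qed
  have dF: "((\<lambda>s. - exp (- L * s) * g (t - s) x y) has_real_derivative h s) (at s)" for s
  proof -
    have "((\<lambda>s. g (t - s) x y) has_real_derivative g' (t - s) * (-1)) (at s)"
      by (rule DERIV_chain2[OF d]) (auto intro!: derivative_eq_intros)
    then show ?thesis
      unfolding h_def by (auto intro!: derivative_eq_intros simp: algebra_simps)
  qed
  \<comment> \<open>Monotonicity makes the telescoped difference nonnegative, so that it can be
    added inside \<open>ennreal\<close>.\<close>
  have mono: "- exp (- L * 0) * g (t - 0) x y \<le> - exp (- L * t) * g (t - t) x y"
    using t by (rule DERIV_nonneg_imp_nondecreasing) (use dF h0 in force)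
  have "(\<integral>\<^sup>+w. weight q E (Suc n) t x y w \<partial>P_eps N) \<le> ennreal (exp (- L * t)) + (\<integral>\<^sup>+s. ennreal (h s) * indicator {0..t} s \<partial>lborel)"
    unfolding nn_integral_weight_Suc[OF N E t q, folded L_def] by (intro add_left_mono nn_integral_mono pt)
  also have "(\<integral>\<^sup>+s. ennreal (h s) * indicator {0..t} s \<partial>lborel) = ennreal ((- exp (- L * t) * g (t - t) x y) - (- exp (- L * 0) * g (t - 0) x y))"
    using nn_integral_FTC_Icc[OF hm dF h0 t] .
  also have "ennreal (exp (- L * t)) + \<dots> = ennreal (g t x y - exp (- L * t) * (g 0 x y - 1))"
    using mono by (subst ennreal_plus[symmetric]) (auto simp: algebra_simps)
  also have "\<dots> \<le> ennreal (g t x y)"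
    using g1 by (intro ennreal_leI) simp
  finally show ?thesis .
qed

section \<open>Collisions before and after the first mark\<close>

lemma mark_time_0 [simp]: "mark_time w x 0 = fst (w (x, 0))"
  and mark_time_Suc: "mark_time w x (Suc n) = mark_time w x n + fst (w (x, Suc n))"
  by (simp_all add: mark_time_def)

definition mark_at :: "marks \<Rightarrow> int \<times> nat \<Rightarrow> real" where
  "mark_at w k = mark_time w (fst k) (snd k)"

text \<open>The pathwise conditions for a decomposition at the first mark. On infinite sets
  \<open>sorted_list_of_set\<close> is empty and \<open>card\<close> is 0, so local finiteness is
  what gives \<open>pos\<close> and \<open>Ncoll\<close> their intended meaning.\<close>

definition regular :: "int set \<Rightarrow> marks \<Rightarrow> bool" where
  "regular E w \<longleftrightarrow> (\<forall>x\<in>E. \<forall>n. 0 < fst (w (x, n))) \<and> inj_on (mark_at w) (E \<times> UNIV) \<and>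
     (\<forall>t. finite {k \<in> E \<times> UNIV. mark_at w k \<le> t})"

lemma finite_inner_pairs [simp]: "finite (inner_pairs N)"
  by (rule finite_subset[of _ "{- int N .. int N}"]) (auto simp: inner_pairs_def Lambda_def)

lemma swp_Lambda: "e \<in> inner_pairs N \<Longrightarrow> x \<in> Lambda N \<Longrightarrow> swp e x \<in> Lambda N"
  by (auto simp: swp_def inner_pairs_def)

lemma pos_Lambda:
  assumes "x \<in> Lambda N" shows "pos w N x s \<in> Lambda N"
proof -
  have set_sl: "set (sorted_list_of_set A) \<subseteq> A" for A :: "int set"
    by (cases "finite A") auto
  have st: "y \<in> Lambda N \<Longrightarrow> step w N r y \<in> Lambda N" for r y
    unfolding step_def
    by (rule fold_invariant[where P="\<lambda>y. y \<in> Lambda N" and Q="\<lambda>e. e \<in> inner_pairs N"])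
      (use set_sl in \<open>auto simp: swp_Lambda\<close>)
  show ?thesis
    unfolding pos_def
    by (rule fold_invariant[where P="\<lambda>y. y \<in> Lambda N" and Q="\<lambda>_. True"]) (use assms st in auto)
qed

lemma fold_cong_set: "(\<And>x. x \<in> set xs \<Longrightarrow> f x = g x) \<Longrightarrow> fold f xs y = fold g xs y"
  by (simp cong: fold_cong)

lemma sorted_list_of_set_plus:
  fixes A :: "real set"
  shows "sorted_list_of_set ((+) c ` A) = map ((+) c) (sorted_list_of_set A)"
proof (cases "finite A")
  case True
  show ?thesis
  proof (rule sorted_distinct_set_unique)
    show "sorted (map ((+) c) (sorted_list_of_set A))"
      by (simp add: sorted_map)
  qed (use True in \<open>auto simp: distinct_map\<close>)
next
  case False
  then have "infinite ((+) c ` A)" by (simp add: finite_image_iff)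
  with False show ?thesis by simp
qed

lemma sorted_list_of_set_insert_less:
  fixes A :: "real set"
  assumes "finite A" "\<And>a. a \<in> A \<Longrightarrow> c < a"
  shows "sorted_list_of_set (insert c A) = c # sorted_list_of_set A"
proof -
  have "A - {c} = A" using assms(2) by auto
  with assms show ?thesis by (simp add: sorted_list_of_set_insert insort_is_Cons less_imp_le)
qed

lemma regular_mark_at_pos:
  assumes "regular E w" "k \<in> E \<times> UNIV" shows "0 < mark_at w k"
proof -
  have g: "0 < fst (w (fst k, n))" for n using assms by (auto simp: regular_def)
  have "0 < mark_time w (fst k) n" for n
    by (induction n) (auto simp: mark_time_Suc g add_pos_pos)
  then show ?thesis by (simp add: mark_at_def)
qed

text \<open>Particles never leave \<open>Lambda N\<close>, so a pair at which they collide is an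
  inner one. Collisions indexed by marks instead of times can be transported through
  \<open>fresh\<close>.\<close>

lemma coll_times_alt:
  assumes "x1 \<in> Lambda N" "x2 \<in> Lambda N" "\<forall>k\<in>inner_pairs N \<times> UNIV. 0 < mark_at v k"
  shows "coll_times v N x1 x2 = mark_at v ` {k \<in> inner_pairs N \<times> UNIV. {pos v N x1 (mark_at v k), pos v N x2 (mark_at v k)} = {fst k, fst k + 1}}"
proof -
  have inE: "x \<in> inner_pairs N" if "{pos v N x1 r, pos v N x2 r} = {x, x + 1}" for r x
  proof -
    have "{x, x + 1} \<subseteq> Lambda N" unfolding that[symmetric] using assms(1,2) by (simp add: pos_Lambda)
    then show ?thesis by (simp add: inner_pairs_def)
  qed
  show ?thesis
  proof (intro equalityI subsetI)
    fix r assume "r \<in> coll_times v N x1 x2"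
    then obtain x n where xn: "mark_time v x n = r" "{pos v N x1 r, pos v N x2 r} = {x, x + 1}"
      by (auto simp: coll_times_def)
    show "r \<in> mark_at v ` {k \<in> inner_pairs N \<times> UNIV. {pos v N x1 (mark_at v k), pos v N x2 (mark_at v k)} = {fst k, fst k + 1}}"
      by (rule image_eqI[of _ _ "(x, n)"]) (use xn inE in \<open>auto simp: mark_at_def\<close>)
  next
    fix r assume "r \<in> mark_at v ` {k \<in> inner_pairs N \<times> UNIV. {pos v N x1 (mark_at v k), pos v N x2 (mark_at v k)} = {fst k, fst k + 1}}"
    then obtain x n where xn: "x \<in> inner_pairs N" "r = mark_at v (x, n)" "{pos v N x1 r, pos v N x2 r} = {x, x + 1}" by auto
    then show "r \<in> coll_times v N x1 x2"
      using assms(3) unfolding coll_times_def mark_at_def by (fastforce intro: less_imp_le)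
  qed
qed

lemma times_before_alt: "times_before v N r = mark_at v ` {k \<in> inner_pairs N \<times> UNIV. mark_at v k < r}"
  unfolding times_before_def mark_at_def by force

lemma finite_times_before: "regular (inner_pairs N) v \<Longrightarrow> finite (times_before v N r)"
proof -
  assume "regular (inner_pairs N) v"
  then have "finite {k \<in> inner_pairs N \<times> UNIV. mark_at v k \<le> r}" by (simp add: regular_def)
  then have "finite {k \<in> inner_pairs N \<times> UNIV. mark_at v k < r}" by (rule rev_finite_subset) auto
  then show ?thesis unfolding times_before_alt by (rule finite_imageI)
qed

section \<open>The path of the particles in terms of the marks restarted at the first one\<close>

locale first_marked =
  fixes N :: nat and w :: marks and e :: int
  assumes reg: "regular (inner_pairs N) w" and e: "e \<in> inner_pairs N" and first: "first_mark (inner_pairs N) e w"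
begin

abbreviation "E \<equiv> inner_pairs N"
abbreviation "w' \<equiv> restart E e w"
abbreviation "s \<equiv> fst (w (e, 0))"
abbreviation "b \<equiv> snd (w (e, 0))"

text \<open>At \<open>e\<close> the first gap is dropped, at the other pairs it is shortened, by
  \<open>s\<close> in both cases; hence all partial sums of gaps drop by \<open>s\<close>.\<close>

lemma mark_time_restart:
  assumes "x \<in> E" shows "mark_time w' x n = mark_at w (fresh e (x, n)) - s"
proof (cases "x = e")
  case True
  have "mark_time w' e n = mark_time w e (Suc n) - s"
    by (induction n) (auto simp: mark_time_Suc restart_def shift_def fresh_def image_iff)
  then show ?thesis using True by (simp add: fresh_def mark_at_def)
next
  case False
  have "mark_time w' x n = mark_time w x n - s"
    by (induction n) (use False assms in \<open>auto simp: mark_time_Suc restart_def shift_def fresh_def image_iff\<close>)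
  then show ?thesis using False by (simp add: fresh_def mark_at_def)
qed

lemma mark_at_restart: "k \<in> E \<times> UNIV \<Longrightarrow> mark_at w (fresh e k) = s + mark_at w' k"
  using mark_time_restart[of "fst k" "snd k"] by (auto simp: mark_at_def)

lemma active_restart: "snd (w' k) = snd (w (fresh e k))"
  by (simp add: restart_def shift_def)

text \<open>Every inner mark is the first one or comes from the restarted configuration. Together
  with \<open>inj_fresh\<close> this is the bijection behind the counting of marks and
  collisions.\<close>

lemma marks_split: "E \<times> UNIV = insert (e, 0) (fresh e ` (E \<times> UNIV))"
proof (intro equalityI subsetI)
  fix k :: "int \<times> nat" assume k: "k \<in> E \<times> UNIV"
  show "k \<in> insert (e, 0) (fresh e ` (E \<times> UNIV))"
  proof (cases "fst k = e \<and> snd k = 0")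
    case True then show ?thesis by (cases k) auto
  next
    case False
    show ?thesis
      by (intro insertI2 image_eqI[of _ _ "(fst k, if fst k = e then snd k - 1 else snd k)"])
        (use k False in \<open>auto simp: fresh_def prod_eq_iff\<close>)
  qed
qed (use e in \<open>auto simp: fresh_def\<close>)

lemma fresh_neq: "fresh e k \<noteq> (e, 0)" by (auto simp: fresh_def)

lemma mark_at_first [simp]: "mark_at w (e, 0) = s" by (simp add: mark_at_def)

lemma gap_restart_pos: "x \<in> E \<Longrightarrow> 0 < fst (w' (x, n))"
  using reg first by (auto simp: regular_def restart_def shift_def fresh_def first_mark_def)

lemma inj_fresh: "inj (fresh e)"
  by (auto simp: inj_def fresh_def split: if_splits)

lemma regular_restart: "regular E w'"
  unfolding regular_def
proof (intro conjI allI ballI)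
  show "0 < fst (w' (x, n))" if "x \<in> E" for x n using gap_restart_pos that .
  show "inj_on (mark_at w') (E \<times> UNIV)"
  proof (rule inj_onI)
    fix k l :: "int \<times> nat" assume kl: "k \<in> E \<times> UNIV" "l \<in> E \<times> UNIV" "mark_at w' k = mark_at w' l"
    then have "mark_at w (fresh e k) = mark_at w (fresh e l)" by (simp add: mark_at_restart)
    moreover have "fresh e k \<in> E \<times> UNIV" "fresh e l \<in> E \<times> UNIV" using kl marks_split by auto
    moreover have "inj_on (mark_at w) (E \<times> UNIV)" using reg by (simp add: regular_def)
    ultimately have "fresh e k = fresh e l" by (meson inj_onD)
    then show "k = l" using inj_fresh by (meson injD)
  qed
  fix t
  have "fresh e ` {k \<in> E \<times> UNIV. mark_at w' k \<le> t} \<subseteq> {k \<in> E \<times> UNIV. mark_at w k \<le> s + t}"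
    using marks_split mark_at_restart by auto
  then have "finite (fresh e ` {k \<in> E \<times> UNIV. mark_at w' k \<le> t})"
    using reg finite_subset unfolding regular_def by blast
  then show "finite {k \<in> E \<times> UNIV. mark_at w' k \<le> t}"
    by (rule finite_imageD) (rule inj_on_subset[OF inj_fresh subset_UNIV])
qed

lemma mark_at_restart_pos: "k \<in> E \<times> UNIV \<Longrightarrow> 0 < mark_at w' k"
  by (rule regular_mark_at_pos[OF regular_restart])

lemma mark_at_restart_pos': "\<forall>k\<in>E \<times> UNIV. 0 < mark_at w' k"
  using mark_at_restart_pos by blast

lemma marks_le:
  assumes "s \<le> t"
  shows "{k \<in> E \<times> UNIV. mark_at w k \<le> t} = insert (e, 0) (fresh e ` {k \<in> E \<times> UNIV. mark_at w' k \<le> t - s})"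
proof -
  have "{k \<in> E \<times> UNIV. mark_at w k \<le> t} = {k \<in> insert (e, 0) (fresh e ` (E \<times> UNIV)). mark_at w k \<le> t}"
    using marks_split by simp
  also have "\<dots> = insert (e, 0) (fresh e ` {k \<in> E \<times> UNIV. mark_at w' k \<le> t - s})"
    using assms by (auto simp: mark_at_restart)
  finally show ?thesis .
qed

lemma card_marks_le:
  assumes "s \<le> t"
  shows "card {k \<in> E \<times> UNIV. mark_at w k \<le> t} = Suc (card {k \<in> E \<times> UNIV. mark_at w' k \<le> t - s})"
proof -
  have "finite {k \<in> E \<times> UNIV. mark_at w' k \<le> t - s}" using regular_restart by (auto simp: regular_def)
  then show ?thesis
    unfolding marks_le[OF assms]
    by (subst card_insert_disjoint) (auto simp: fresh_neq[symmetric] card_image inj_on_subset[OF inj_fresh])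
qed

text \<open>The predicate \<open>P\<close> covers both uses in \<open>step\<close>: constant truth
  selects the pairs that ring at time \<open>r\<close>, the identity those with an active
  mark.\<close>

lemma ex_mark_later:
  assumes x: "x \<in> E" and r: "s < r"
  shows "(\<exists>n. mark_time w x n = r \<and> P (snd (w (x, n)))) \<longleftrightarrow> (\<exists>n. mark_time w' x n = r - s \<and> P (snd (w' (x, n))))"
proof
  assume "\<exists>n. mark_time w x n = r \<and> P (snd (w (x, n)))"
  then obtain n where n: "mark_at w (x, n) = r" "P (snd (w (x, n)))" by (auto simp: mark_at_def)
  have "(x, n) \<noteq> (e, 0)"
  proof
    assume "(x, n) = (e, 0)"
    with n r show False by simp
  qed
  with x marks_split obtain k where k: "k \<in> E \<times> UNIV" "(x, n) = fresh e k" by blast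
  then have "fst k = x" by (cases k) (auto simp: fresh_def split: if_splits)
  with k obtain m where m: "(x, n) = fresh e (x, m)" by (cases k) auto
  have "mark_time w' x m = r - s" using mark_time_restart[OF x, of m] n m by simp
  with n m show "\<exists>n. mark_time w' x n = r - s \<and> P (snd (w' (x, n)))" by (auto simp: active_restart)
next
  assume "\<exists>n. mark_time w' x n = r - s \<and> P (snd (w' (x, n)))"
  then obtain m where m: "mark_time w' x m = r - s" "P (snd (w' (x, m)))" by auto
  obtain n where n: "fresh e (x, m) = (x, n)" by (cases "x = e") (auto simp: fresh_def)
  with m mark_time_restart[OF x, of m] show "\<exists>n. mark_time w x n = r \<and> P (snd (w (x, n)))"
    by (auto simp: active_restart mark_at_def)
qed

lemma mark_at_less: "k \<in> E \<times> UNIV \<Longrightarrow> k \<noteq> (e, 0) \<Longrightarrow> s < mark_at w k"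
proof -
  assume k: "k \<in> E \<times> UNIV" "k \<noteq> (e, 0)"
  then obtain l where "k = fresh e l" "l \<in> E \<times> UNIV" using marks_split by blast
  then show "s < mark_at w k" using mark_at_restart mark_at_restart_pos by fastforce
qed

lemma mark_at_ge: "k \<in> E \<times> UNIV \<Longrightarrow> s \<le> mark_at w k"
  using mark_at_less[of k] by (cases "k = (e, 0)") (simp_all add: less_imp_le)

lemma marks_le_empty: "t < s \<Longrightarrow> {k \<in> E \<times> UNIV. mark_at w k \<le> t} = {}"
proof -
  assume t: "t < s"
  have "\<not> mark_at w k \<le> t" if "k \<in> E \<times> UNIV" for k using mark_at_ge[OF that] t by linarith
  then show ?thesis by blast
qed

lemma step_first: "step w N s y = move e b y"
proof -
  have *: "x \<in> E \<Longrightarrow> mark_time w x n = s \<longleftrightarrow> x = e \<and> n = 0" for x n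
    using mark_at_less[of "(x, n)"] by (cases "(x, n) = (e, 0)") (auto simp: mark_at_def)
  have "{x \<in> E. \<exists>n. mark_time w x n = s} = {e}" using * e by auto
  moreover have "(\<exists>n. mark_time w e n = s \<and> snd (w (e, n))) \<longleftrightarrow> b" using * e by auto
  ultimately show ?thesis by (simp add: step_def move_def)
qed

lemma step_later:
  assumes "s < r" shows "step w N r = step w' N (r - s)"
proof
  fix y
  have *: "{x \<in> E. \<exists>n. mark_time w x n = r} = {x \<in> E. \<exists>n. mark_time w' x n = r - s}"
    using ex_mark_later[OF _ assms, of _ "\<lambda>_. True"] by auto
  show "step w N r y = step w' N (r - s) y"
    unfolding step_def *
  proof (rule fold_cong_set)
    fix x assume "x \<in> set (sorted_list_of_set {x \<in> E. \<exists>n. mark_time w' x n = r - s})"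
    then have "x \<in> E" by simp
    from ex_mark_later[OF this assms, of "\<lambda>b. b"]
    show "(\<lambda>y. if \<exists>n. mark_time w x n = r \<and> snd (w (x, n)) then swp x y else y) =
      (\<lambda>y. if \<exists>n. mark_time w' x n = r - s \<and> snd (w' (x, n)) then swp x y else y)" by simp
  qed
qed

lemma times_before_later:
  assumes "s < r" shows "times_before w N r = insert s ((+) s ` times_before w' N (r - s))"
proof -
  have "{k \<in> E \<times> UNIV. mark_at w k < r} = {k \<in> insert (e, 0) (fresh e ` (E \<times> UNIV)). mark_at w k < r}"
    using marks_split by simp
  also have "\<dots> = insert (e, 0) (fresh e ` {k \<in> E \<times> UNIV. mark_at w' k < r - s})"
    using assms by (auto simp: mark_at_restart)
  finally show ?thesis unfolding times_before_alt by (auto simp: mark_at_restart image_image)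
qed

lemma times_before_pos: "u \<in> times_before w' N r \<Longrightarrow> 0 < u"
  unfolding times_before_alt using mark_at_restart_pos by blast

text \<open>The case \<open>r = s\<close> is included because \<open>pos\<close> is a left limit:
  the first mark has not acted yet.\<close>

lemma pos_first: "r \<le> s \<Longrightarrow> pos w N x r = x"
proof -
  assume r: "r \<le> s"
  have "\<not> mark_at w k < r" if "k \<in> E \<times> UNIV" for k
    using mark_at_ge[OF that] r by linarith
  then have "times_before w N r = {}" unfolding times_before_alt by blast
  then show ?thesis by (simp add: pos_def)
qed

text \<open>The sorted mark times before \<open>r\<close> begin with \<open>s\<close>, whose step is
  \<open>move e b\<close>; the others are restarted mark times translated by \<open>s\<close> and
  act as they do there.\<close>

lemma pos_later: "s < r \<Longrightarrow> pos w N x r = pos w' N (move e b x) (r - s)"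
proof -
  assume r: "s < r"
  let ?B = "times_before w' N (r - s)"
  have B: "finite ?B" by (rule finite_times_before[OF regular_restart])
  have "sorted_list_of_set (insert s ((+) s ` ?B)) = s # map ((+) s) (sorted_list_of_set ?B)"
    using B times_before_pos by (subst sorted_list_of_set_insert_less) (auto simp: sorted_list_of_set_plus)
  then have "pos w N x r = fold (\<lambda>u. step w N (s + u)) (sorted_list_of_set ?B) (move e b x)"
    unfolding pos_def times_before_later[OF r] by (simp add: step_first fold_map comp_def)
  also have "\<dots> = fold (step w' N) (sorted_list_of_set ?B) (move e b x)"
    by (rule fold_cong_set) (use B times_before_pos in \<open>auto simp: step_later\<close>)
  finally show ?thesis by (simp add: pos_def)
qed

lemma move_Lambda: "x \<in> Lambda N \<Longrightarrow> move e c x \<in> Lambda N"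
  using e by (simp add: move_def swp_Lambda)

text \<open>The mark \<open>(e, 0)\<close> sees the initial positions, all other marks see those of
  the restarted path.\<close>

lemma coll_times_split:
  assumes x: "x1 \<in> Lambda N" "x2 \<in> Lambda N"
  shows "coll_times w N x1 x2 = (if {x1, x2} = {e, e + 1} then {s} else {}) \<union>
    (+) s ` coll_times w' N (move e b x1) (move e b x2)"
proof -
  have mp: "\<forall>k\<in>E \<times> UNIV. 0 < mark_at w k" using regular_mark_at_pos[OF reg] by blast
  define A where "A k \<longleftrightarrow> {pos w N x1 (mark_at w k), pos w N x2 (mark_at w k)} = {fst k, fst k + 1}" for k
  define B where "B k \<longleftrightarrow> {pos w' N (move e b x1) (mark_at w' k), pos w' N (move e b x2) (mark_at w' k)} = {fst k, fst k + 1}" for k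
  have A0: "A (e, 0) \<longleftrightarrow> {x1, x2} = {e, e + 1}" by (simp add: A_def pos_first)
  have AB: "A (fresh e k) \<longleftrightarrow> B k" if "k \<in> E \<times> UNIV" for k
  proof -
    have "pos w N y (mark_at w (fresh e k)) = pos w' N (move e b y) (mark_at w' k)" for y
      using mark_at_restart[OF that] mark_at_restart_pos[OF that] by (simp add: pos_later)
    moreover have "fst (fresh e k) = fst k" by (simp add: fresh_def)
    ultimately show ?thesis by (simp add: A_def B_def)
  qed
  have *: "{k \<in> E \<times> UNIV. A k} = (if {x1, x2} = {e, e + 1} then {(e, 0)} else {}) \<union> fresh e ` {k \<in> E \<times> UNIV. B k}"
  proof -
    have "{k \<in> E \<times> UNIV. A k} = {k \<in> insert (e, 0) (fresh e ` (E \<times> UNIV)). A k}"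
      by (subst marks_split) (rule refl)
    also have "\<dots> = (if A (e, 0) then {(e, 0)} else {}) \<union> fresh e ` {k \<in> E \<times> UNIV. A (fresh e k)}"
      by auto
    also have "{k \<in> E \<times> UNIV. A (fresh e k)} = {k \<in> E \<times> UNIV. B k}" using AB by blast
    finally show ?thesis unfolding A0 .
  qed
  have img: "mark_at w ` ((if Q then {(e, 0)} else {}) \<union> fresh e ` B) = (if Q then {s} else {}) \<union> (+) s ` mark_at w' ` B"
    if "B \<subseteq> E \<times> UNIV" for B Q
  proof -
    have "mark_at w ` fresh e ` B = (+) s ` mark_at w' ` B"
      unfolding image_image using that by (intro image_cong refl mark_at_restart) auto
    then show ?thesis by (simp add: image_Un)
  qed
  show ?thesis
    unfolding coll_times_alt[where v=w, OF x mp] coll_times_alt[where v=w', OF move_Lambda[OF x(1)] move_Lambda[OF x(2)] mark_at_restart_pos']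
      A_def[symmetric] B_def[symmetric] *
    by (rule img[of _ "{x1, x2} = {e, e + 1}"]) auto
qed

text \<open>The pathwise counterpart of the recursion that defines \<open>weight\<close>.\<close>

lemma Ncoll_split:
  assumes x: "x1 \<in> Lambda N" "x2 \<in> Lambda N"
  shows "Ncoll w N x1 x2 t = (if t < s then 0 else (if {x1, x2} = {e, e + 1} then 1 else 0) +
    Ncoll w' N (move e b x1) (move e b x2) (t - s))"
proof -
  let ?C = "coll_times w' N (move e b x1) (move e b x2)"
  have C: "?C \<subseteq> mark_at w' ` (E \<times> UNIV)"
    unfolding coll_times_alt[where v=w', OF move_Lambda[OF x(1)] move_Lambda[OF x(2)] mark_at_restart_pos'] by auto
  have Cpos: "r \<in> ?C \<Longrightarrow> 0 < r" for r using C mark_at_restart_pos by blast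
  have fin: "finite {r \<in> ?C. r \<le> t - s}"
  proof (rule finite_subset)
    show "{r \<in> ?C. r \<le> t - s} \<subseteq> mark_at w' ` {k \<in> E \<times> UNIV. mark_at w' k \<le> t - s}" using C by auto
    show "finite (mark_at w' ` {k \<in> E \<times> UNIV. mark_at w' k \<le> t - s})"
      using regular_restart by (auto simp: regular_def)
  qed
  show ?thesis
  proof (cases "t < s")
    case True
    then have "{r \<in> coll_times w N x1 x2. r \<le> t} = {}"
      unfolding coll_times_split[OF x] using Cpos by force
    then show ?thesis using True by (simp only: Ncoll_def card.empty if_True)
  next
    case False
    have "{r \<in> coll_times w N x1 x2. r \<le> t} = (if {x1, x2} = {e, e + 1} then {s} else {}) \<union> (+) s ` {r \<in> ?C. r \<le> t - s}"
      unfolding coll_times_split[OF x] using False by auto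
    moreover have "card ((if {x1, x2} = {e, e + 1} then {s} else {}) \<union> (+) s ` {r \<in> ?C. r \<le> t - s})
      = card (if {x1, x2} = {e, e + 1} then {s} else {}) + card ((+) s ` {r \<in> ?C. r \<le> t - s})"
    proof (rule card_Un_disjoint)
      \<comment> \<open>A restarted collision at time 0 would coincide with the one at
        \<open>s\<close>; restarted marks have strictly positive times.\<close>
      have "s \<notin> (+) s ` {r \<in> ?C. r \<le> t - s}"
      proof
        assume "s \<in> (+) s ` {r \<in> ?C. r \<le> t - s}"
        then have "0 \<in> ?C" by auto
        then show False using Cpos by blast
      qed
      then show "(if {x1, x2} = {e, e + 1} then {s} else {}) \<inter> (+) s ` {r \<in> ?C. r \<le> t - s} = {}" by simp
    qed (use fin in auto)
    moreover have "card ((+) s ` {r \<in> ?C. r \<le> t - s}) = card {r \<in> ?C. r \<le> t - s}"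
      by (simp add: card_image)
    ultimately show ?thesis using False by (simp add: Ncoll_def)
  qed
qed

end

section \<open>Identification of \<open>weight\<close> with powers of the collision number\<close>

lemma regular_ex_first_mark:
  assumes "regular E w" "finite E" "E \<noteq> {}"
  obtains e where "e \<in> E" "first_mark E e w"
proof -
  obtain e where e: "e \<in> E" "\<And>x. x \<in> E \<Longrightarrow> fst (w (e, 0)) \<le> fst (w (x, 0))"
    using ex_is_arg_min_if_finite[OF assms(2,3), of "\<lambda>x. fst (w (x, 0))"] by (auto simp: is_arg_min_linorder)
  have "fst (w (e, 0)) \<noteq> fst (w (x, 0))" if "x \<in> E" "x \<noteq> e" for x
  proof
    assume "fst (w (e, 0)) = fst (w (x, 0))"
    then have "mark_at w (e, 0) = mark_at w (x, 0)" by (simp add: mark_at_def)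
    then show False using assms(1) e(1) that unfolding regular_def inj_on_def by blast
  qed
  with e show thesis by (intro that[of e]) (force simp: first_mark_def)+
qed

text \<open>Passing the first mark lowers the number of marks by one (\<open>card_marks_le\<close>)
  and splits the collision number (\<open>Ncoll_split\<close>), in step with the recursion of
  \<open>weight\<close>.\<close>

lemma weight_eq_Ncoll:
  assumes N: "N \<ge> 1" and q: "q \<ge> 0"
    and "regular (inner_pairs N) w" "x1 \<in> Lambda N" "x2 \<in> Lambda N"
  shows "weight q (inner_pairs N) n t x1 x2 w =
    (if card {k \<in> inner_pairs N \<times> UNIV. mark_at w k \<le> t} < n then ennreal (q ^ Ncoll w N x1 x2 t) else 0)"
  using assms(3-)
proof (induction n arbitrary: t x1 x2 w)
  case 0
  then show ?case by simp
next
  case (Suc n)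
  let ?E = "inner_pairs N"
  have "0 \<in> ?E" using N by (auto simp: inner_pairs_def Lambda_def)
  then have "?E \<noteq> {}" by blast
  then obtain e where e: "e \<in> ?E" "first_mark ?E e w"
    by (rule regular_ex_first_mark[OF Suc.prems(1) finite_inner_pairs])
  then interpret first_marked N w e using Suc.prems(1) by unfold_locales
  \<comment> \<open>Exactly one pair rings first, so the sum in \<open>weight\<close> collapses to a
    single summand.\<close>
  have uniq: "first_mark ?E x w \<longleftrightarrow> x = e" if "x \<in> ?E" for x
  proof
    assume "first_mark ?E x w"
    then have "x \<noteq> e \<Longrightarrow> fst (w (x, 0)) < fst (w (e, 0))" using e by (simp add: first_mark_def)
    moreover have "x \<noteq> e \<Longrightarrow> fst (w (e, 0)) < fst (w (x, 0))" using first that by (simp add: first_mark_def)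
    ultimately show "x = e" by fastforce
  qed (use first in simp)
  define A where "A x = indicator {..t} (fst (w (x, 0))) * (ennreal (coll_weight q x x1 x2) *
       weight q ?E n (t - fst (w (x, 0))) (move x (snd (w (x, 0))) x1) (move x (snd (w (x, 0))) x2) (restart ?E x w))" for x
  have "(\<Sum>x\<in>?E. indicator {w. first_mark ?E x w} w * A x) = (\<Sum>x\<in>?E. if x = e then A x else 0)"
    by (intro sum.cong refl) (auto simp: uniq)
  then have sumE: "(\<Sum>x\<in>?E. indicator {w. first_mark ?E x w} w * A x) = A e" using e by simp
  have all: "(\<forall>k\<in>(\<lambda>x. (x, 0)) ` ?E. t < fst (w k)) \<longleftrightarrow> t < s"
  proof
    assume "t < s"
    moreover have "s \<le> fst (w (x, 0))" if "x \<in> ?E" for x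
      using first that by (cases "x = e") (auto simp: first_mark_def less_imp_le)
    ultimately show "\<forall>k\<in>(\<lambda>x. (x, 0)) ` ?E. t < fst (w k)" by fastforce
  qed (use e in auto)
  have W: "weight q ?E (Suc n) t x1 x2 w = indicator {..<s} t + A e"
    using sumE all unfolding weight.simps A_def by (auto simp: indicator_def)
  show ?case
  proof (cases "t < s")
    case True
    have c0: "card {k \<in> ?E \<times> UNIV. mark_at w k \<le> t} = 0" by (simp only: marks_le_empty[OF True] card.empty)
    have n0: "Ncoll w N x1 x2 t = 0" using True by (simp add: Ncoll_split[OF Suc.prems(2,3)])
    show ?thesis unfolding W c0 n0 using True by (simp add: A_def)
  next
    case False
    have "A e = ennreal (coll_weight q e x1 x2) * weight q ?E n (t - s) (move e b x1) (move e b x2) w'"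
      using False by (simp add: A_def)
    also have "\<dots> = ennreal (coll_weight q e x1 x2) * (if card {k \<in> ?E \<times> UNIV. mark_at w' k \<le> t - s} < n
       then ennreal (q ^ Ncoll w' N (move e b x1) (move e b x2) (t - s)) else 0)"
      by (subst Suc.IH[OF regular_restart]) (use Suc.prems in \<open>auto simp: move_Lambda\<close>)
    finally have Ae: "A e = \<dots>" .
    have c1: "card {k \<in> ?E \<times> UNIV. mark_at w k \<le> t} = Suc (card {k \<in> ?E \<times> UNIV. mark_at w' k \<le> t - s})"
      using False by (intro card_marks_le) simp
    have n1: "Ncoll w N x1 x2 t = (if {x1, x2} = {e, e + 1} then 1 else 0) + Ncoll w' N (move e b x1) (move e b x2) (t - s)"
      using False by (simp add: Ncoll_split[OF Suc.prems(2,3)])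
    have "coll_weight q e x1 x2 * q ^ Ncoll w' N (move e b x1) (move e b x2) (t - s) = q ^ Ncoll w N x1 x2 t"
      unfolding n1 by (simp add: coll_weight_def)
    then have qn: "ennreal (coll_weight q e x1 x2) * ennreal (q ^ Ncoll w' N (move e b x1) (move e b x2) (t - s)) = ennreal (q ^ Ncoll w N x1 x2 t)"
      using q by (simp add: ennreal_mult''[symmetric])
    show ?thesis unfolding W Ae c1 using False by (simp add: qn)
  qed
qed

section \<open>Almost sure regularity of the marks\<close>

lemma AE_mark_law:
  assumes [measurable]: "Measurable.pred borel Q" and AE: "AE s in lborel. 0 \<le> s \<longrightarrow> Q s"
  shows "AE x in mark_law N. Q (fst x)"
proof -
  let ?A = "{x \<in> space (mark_law N). \<not> Q (fst x)}"
  have A: "?A \<in> sets (mark_law N)" by measurable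
  have "emeasure (mark_law N) ?A = (\<integral>\<^sup>+x. indicator {s. \<not> Q s} (fst x) \<partial>mark_law N)"
  proof -
    have "indicator ?A x = (indicator {s. \<not> Q s} (fst x) :: ennreal)" for x :: "real \<times> bool"
      by (simp add: indicator_def)
    then show ?thesis using nn_integral_indicator[OF A] by simp
  qed
  also have "\<dots> = (\<integral>\<^sup>+s. ennreal (exponential_density ((real N)\<^sup>2) s) *
      ((indicator {s. \<not> Q s} s + indicator {s. \<not> Q s} s) / 2) \<partial>lborel)"
    by (subst nn_integral_mark_law) auto
  also have "\<dots> = 0"
    by (rule nn_integral_zero') (use AE in \<open>auto elim!: eventually_mono simp: exponential_density_def\<close>)
  finally show ?thesis using A by (intro AE_I'[of ?A]) auto
qed

lemma AE_gap_pos: assumes N: "N \<ge> 1" shows "AE w in P_eps N. 0 < fst (w k)"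
  unfolding P_eps_def
proof (rule AE_PiM_resample[OF prob_space_mark_law[OF N], where k=k])
  show "Measurable.pred (Pi\<^sub>M UNIV (\<lambda>_. mark_law N)) (\<lambda>w. 0 < fst (w k))"
    unfolding P_eps_def[symmetric] by measurable
  have ne: "AE s in lborel. s \<noteq> (0::real)" by (rule AE_lborel_singleton)
  have "AE x in mark_law N. 0 < fst x"
    by (rule AE_mark_law) (use ne in \<open>auto elim!: eventually_mono\<close>)
  then show "AE x in mark_law N. 0 < fst ((w(k := x)) k)" for w :: marks by simp
qed

lemma measurable_mark_at [measurable]: "(\<lambda>w. mark_at w k) \<in> borel_measurable (P_eps N)"
  unfolding mark_at_def mark_time_def by measurable

text \<open>Changing the first gap of a pair translates all its mark times and leaves those of other
  pairs alone. Redrawing this one gap therefore destroys coincidences.\<close>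

lemma mark_time_upd:
  "mark_time (w((x, 0) := z)) y n = (if y = x then fst z - fst (w (x, 0)) else 0) + mark_time w y n"
  by (induction n) (auto simp: mark_time_Suc)

text \<open>With the other gaps frozen, equality holds for a single value of the first gap of the
  pair, a Lebesgue null set.\<close>

lemma AE_mark_at_neq_const: assumes N: "N \<ge> 1" shows "AE w in P_eps N. mark_at w k \<noteq> t"
  unfolding P_eps_def
proof (rule AE_PiM_resample[OF prob_space_mark_law[OF N], where k="(fst k, 0)"])
  show "Measurable.pred (Pi\<^sub>M UNIV (\<lambda>_. mark_law N)) (\<lambda>w. mark_at w k \<noteq> t)"
    unfolding P_eps_def[symmetric] by measurable
  fix w :: marks
  have "AE s in lborel. s \<noteq> t + fst (w (fst k, 0)) - mark_at w k" by (rule AE_lborel_singleton)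
  then have "AE x in mark_law N. fst x \<noteq> t + fst (w (fst k, 0)) - mark_at w k"
    by (intro AE_mark_law) (auto elim!: eventually_mono)
  then show "AE x in mark_law N. mark_at (w((fst k, 0) := x)) k \<noteq> t"
    by eventually_elim (simp add: mark_at_def mark_time_upd)
qed

text \<open>As for a constant time: the pairs differ, so \<open>mark_at w l\<close> stays put when
  the first gap at \<open>fst k\<close> is redrawn. Coincidences at one pair are excluded by
  positive gaps.\<close>

lemma AE_mark_at_neq:
  assumes N: "N \<ge> 1" and kl: "fst k \<noteq> fst l" shows "AE w in P_eps N. mark_at w k \<noteq> mark_at w l"
  unfolding P_eps_def
proof (rule AE_PiM_resample[OF prob_space_mark_law[OF N], where k="(fst k, 0)"])
  show "Measurable.pred (Pi\<^sub>M UNIV (\<lambda>_. mark_law N)) (\<lambda>w. mark_at w k \<noteq> mark_at w l)"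
  proof -
    have "{w \<in> space (P_eps N). mark_at w k = mark_at w l} \<in> sets (P_eps N)"
      by (rule borel_measurable_eq) measurable
    then show ?thesis unfolding P_eps_def[symmetric] pred_def by measurable
  qed
  fix w :: marks
  have "AE s in lborel. s \<noteq> mark_at w l + fst (w (fst k, 0)) - mark_at w k" by (rule AE_lborel_singleton)
  then have "AE x in mark_law N. fst x \<noteq> mark_at w l + fst (w (fst k, 0)) - mark_at w k"
    by (intro AE_mark_law) (auto elim!: eventually_mono)
  then show "AE x in mark_law N. mark_at (w((fst k, 0) := x)) k \<noteq> mark_at (w((fst k, 0) := x)) l"
    by eventually_elim (use kl in \<open>simp add: mark_at_def mark_time_upd\<close>)
qed

section \<open>Laplace transforms of the mark times and absence of explosion\<close>

lemma nn_integral_exp_mark_law: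
  assumes N: "N \<ge> 1"
  shows "(\<integral>\<^sup>+x. ennreal (exp (- fst x)) \<partial>mark_law N) = ennreal ((real N)\<^sup>2 / ((real N)\<^sup>2 + 1))"
proof -
  let ?l = "(real N)\<^sup>2"
  have l: "?l > 0" using N by simp
  interpret D: prob_space "density lborel (exponential_density (?l + 1))"
    by (rule prob_space_exponential_density) (use l in linarith)
  have half: "(ennreal a + ennreal a) / 2 = ennreal a" if "a \<ge> 0" for a
    using that by (metis add_nonneg_nonneg divide_ennreal ennreal_numeral ennreal_plus field_sum_of_halves add_divide_distrib zero_less_numeral zero_le_numeral)
  have "(\<integral>\<^sup>+x. ennreal (exp (- fst x)) \<partial>mark_law N) = (\<integral>\<^sup>+s. ennreal (exponential_density ?l s) * ennreal (exp (- s)) \<partial>lborel)"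
    by (subst nn_integral_mark_law) (auto simp: half)
  also have "\<dots> = (\<integral>\<^sup>+s. ennreal (?l / (?l + 1)) * ennreal (exponential_density (?l + 1) s) \<partial>lborel)"
  proof (rule nn_integral_cong)
    fix s :: real
    \<comment> \<open>Tilting the exponential density of rate \<open>?l\<close> by
      \<open>exp (- s)\<close> gives the one of rate \<open>?l + 1\<close>, up to
      normalisation.\<close>
    have "exponential_density ?l s * exp (- s) = ?l / (?l + 1) * exponential_density (?l + 1) s"
    proof -
      have e: "exp (- s * (?l + 1)) = exp (- s * ?l) * exp (- s)" by (simp add: algebra_simps flip: exp_add)
      have "?l + 1 \<noteq> 0" using l by linarith
      then show ?thesis unfolding exponential_density_def e by simp
    qed
    then show "ennreal (exponential_density ?l s) * ennreal (exp (- s)) = ennreal (?l / (?l + 1)) * ennreal (exponential_density (?l + 1) s)"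
      using l by (simp add: ennreal_mult''[symmetric] exponential_density_nonneg del: times_divide_eq_left)
  qed
  also have "\<dots> = ennreal (?l / (?l + 1)) * (\<integral>\<^sup>+s. ennreal (exponential_density (?l + 1) s) \<partial>lborel)"
    by (rule nn_integral_cmult) simp
  also have "(\<integral>\<^sup>+s. ennreal (exponential_density (?l + 1) s) \<partial>lborel) = 1"
    using D.emeasure_space_1 by (simp add: emeasure_density)
  finally show ?thesis by simp
qed

text \<open>The gaps are independent, so the transform is a power; mark \<open>n\<close> ends
  \<open>n + 1\<close> gaps, whence \<open>Suc n\<close>. The induction peels off the first gap with
  \<open>fresh\<close>.\<close>

lemma nn_integral_exp_mark_time:
  assumes N: "N \<ge> 1"
  shows "(\<integral>\<^sup>+w. ennreal (exp (- mark_time w x n)) \<partial>P_eps N) = ennreal (((real N)\<^sup>2 / ((real N)\<^sup>2 + 1)) ^ Suc n)"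
proof -
  let ?r = "(real N)\<^sup>2 / ((real N)\<^sup>2 + 1)"
  interpret P: prob_space "P_eps N" by (rule prob_space_P_eps[OF N])
  note M = prob_space_mark_law[OF N]
  have inj: "inj (fresh x)" "(x, 0) \<notin> range (fresh x)"
    by (auto simp: inj_def fresh_def split: if_splits)
  have [measurable]: "(\<lambda>w. mark_time w x n) \<in> borel_measurable (P_eps N)" for n
    unfolding mark_time_def by measurable
  have step: "(\<integral>\<^sup>+w. ennreal (exp (- fst (w (x, 0)))) * G (\<lambda>k. w (fresh x k)) \<partial>P_eps N) = ennreal ?r * (\<integral>\<^sup>+w. G w \<partial>P_eps N)"
    if [measurable]: "G \<in> borel_measurable (P_eps N)" for G
  proof -
    have "(\<lambda>z. ennreal (exp (- fst (fst z))) * G (snd z)) \<in> borel_measurable (mark_law N \<Otimes>\<^sub>M P_eps N)"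
      by measurable
    from nn_integral_PiM_fresh[OF M inj this[unfolded P_eps_def]]
    have "(\<integral>\<^sup>+w. ennreal (exp (- fst (w (x, 0)))) * G (\<lambda>k. w (fresh x k)) \<partial>P_eps N)
      = (\<integral>\<^sup>+z. \<integral>\<^sup>+w. ennreal (exp (- fst z)) * G w \<partial>P_eps N \<partial>mark_law N)"
      by (simp add: P_eps_def)
    also have "\<dots> = (\<integral>\<^sup>+z. ennreal (exp (- fst z)) * (\<integral>\<^sup>+w. G w \<partial>P_eps N) \<partial>mark_law N)"
      by (intro nn_integral_cong nn_integral_cmult) measurable
    also have "\<dots> = ennreal ?r * (\<integral>\<^sup>+w. G w \<partial>P_eps N)"
      by (subst nn_integral_multc) (auto simp: nn_integral_exp_mark_law[OF N])
    finally show ?thesis .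
  qed
  show ?thesis
  proof (induction n)
    case 0
    show ?case using step[of "\<lambda>_. 1"] P.emeasure_space_1 by simp
  next
    case (Suc n)
    have sh: "mark_time w x (Suc n) = fst (w (x, 0)) + mark_time (\<lambda>k. w (fresh x k)) x n" for w
      by (induction n) (auto simp: mark_time_Suc fresh_def)
    have "(\<integral>\<^sup>+w. ennreal (exp (- mark_time w x (Suc n))) \<partial>P_eps N)
      = (\<integral>\<^sup>+w. ennreal (exp (- fst (w (x, 0)))) * ennreal (exp (- mark_time (\<lambda>k. w (fresh x k)) x n)) \<partial>P_eps N)"
      unfolding sh by (intro nn_integral_cong) (simp add: ennreal_mult'[symmetric] mult_exp_exp)
    also have "\<dots> = ennreal ?r * ennreal (?r ^ Suc n)"
      by (subst step) (auto simp: Suc.IH)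
    also have "\<dots> = ennreal (?r ^ Suc (Suc n))"
      by (subst ennreal_mult'[symmetric]) auto
    finally show ?case .
  qed
qed

text \<open>Chernoff bound: for every \<open>n\<close>, the event that no mark comes after
  \<open>t\<close> has probability at most \<open>exp t * ?r ^ Suc n\<close>, and
  \<open>?r < 1\<close>.\<close>

lemma AE_mark_time_unbounded:
  assumes N: "N \<ge> 1" shows "AE w in P_eps N. \<exists>n. t < mark_time w x n"
proof -
  let ?r = "(real N)\<^sup>2 / ((real N)\<^sup>2 + 1)"
  have [measurable]: "(\<lambda>w. mark_time w x n) \<in> borel_measurable (P_eps N)" for n
    unfolding mark_time_def by measurable
  let ?A = "{w \<in> space (P_eps N). \<not> (\<exists>n. t < mark_time w x n)}"
  have A: "?A \<in> sets (P_eps N)" by measurable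
  have bound: "emeasure (P_eps N) ?A \<le> ennreal (exp t * ?r ^ Suc n)" for n
  proof -
    have "emeasure (P_eps N) ?A = (\<integral>\<^sup>+w. indicator ?A w \<partial>P_eps N)" using A by simp
    also have "\<dots> \<le> (\<integral>\<^sup>+w. ennreal (exp t) * ennreal (exp (- mark_time w x n)) \<partial>P_eps N)"
    proof (rule nn_integral_mono)
      fix w :: marks
      show "indicator ?A w \<le> ennreal (exp t) * ennreal (exp (- mark_time w x n))"
      proof (cases "w \<in> ?A")
        case True
        then have "mark_time w x n \<le> t" by (auto simp: not_less)
        then have "1 \<le> exp t * exp (- mark_time w x n)" by (simp add: mult_exp_exp)
        with True show ?thesis by (simp add: ennreal_mult'[symmetric] ennreal_leI[of 1, simplified])
      qed simp
    qed
    also have "\<dots> = ennreal (exp t) * ennreal (?r ^ Suc n)"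
      by (subst nn_integral_cmult) (auto simp: nn_integral_exp_mark_time[OF N])
    also have "\<dots> = ennreal (exp t * ?r ^ Suc n)"
      by (rule ennreal_mult'[symmetric]) simp
    finally show ?thesis .
  qed
  have p: "(real N)\<^sup>2 + 1 > 0" by (rule add_nonneg_pos) simp_all
  have r: "0 \<le> ?r" "?r < 1" using p by simp_all
  have "(\<lambda>n. exp t * ?r ^ Suc n) \<longlonglongrightarrow> exp t * 0"
    by (rule tendsto_mult[OF tendsto_const LIMSEQ_Suc[OF LIMSEQ_realpow_zero[OF r]]])
  then have "(\<lambda>n. ennreal (exp t * ?r ^ Suc n)) \<longlonglongrightarrow> ennreal 0"
    using tendsto_ennrealI by fastforce
  then have "emeasure (P_eps N) ?A \<le> 0"
    using bound by (intro LIMSEQ_le_const[of "\<lambda>n. ennreal (exp t * ?r ^ Suc n)"]) auto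
  then show ?thesis using A by (intro AE_I'[of ?A]) auto
qed

lemma AE_regular:
  assumes N: "N \<ge> 1" and E: "finite E" shows "AE w in P_eps N. regular E w"
proof -
  have "AE w in P_eps N. \<forall>k. 0 < fst (w k)"
    unfolding AE_all_countable using AE_gap_pos[OF N] by blast
  moreover have "AE w in P_eps N. \<forall>k l. fst k \<noteq> fst l \<longrightarrow> mark_at w k \<noteq> mark_at w l"
    unfolding AE_all_countable using AE_mark_at_neq[OF N] by auto
  \<comment> \<open>Integer horizons keep the almost sure quantifier countable; a real time is later
    bounded by one of them.\<close>
  moreover have "AE w in P_eps N. \<forall>x. \<forall>t::nat. \<exists>n. real t < mark_time w x n"
    unfolding AE_all_countable using AE_mark_time_unbounded[OF N] by blast
  ultimately show ?thesis
  proof eventually_elim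
    case (elim w)
    have sm: "strict_mono (mark_time w x)" for x
      using elim(1) by (intro strict_mono_Suc_iff[THEN iffD2]) (auto simp: mark_time_Suc)
    show ?case
      unfolding regular_def
    proof (intro conjI allI ballI)
      show "0 < fst (w (x, n))" for x n using elim(1) by blast
      show "inj_on (mark_at w) (E \<times> UNIV)"
      proof (rule inj_onI)
        fix k l assume "mark_at w k = mark_at w l"
        with elim(2) have "fst k = fst l" by blast
        moreover from this \<open>mark_at w k = mark_at w l\<close> have "snd k = snd l"
          using strict_mono_eq[OF sm] by (simp add: mark_at_def)
        ultimately show "k = l" by (simp add: prod_eq_iff)
      qed
      fix t
      obtain m :: nat where m: "t \<le> real m" using real_arch_simple by blast
      from elim(3) have "\<forall>x. \<exists>n. real m < mark_time w x n" by blast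
      then obtain n where n: "\<And>x. real m < mark_time w x (n x)" by metis
      have "{k \<in> E \<times> UNIV. mark_at w k \<le> t} \<subseteq> (SIGMA x:E. {..<n x})"
      proof
        fix k assume k: "k \<in> {k \<in> E \<times> UNIV. mark_at w k \<le> t}"
        then have "mark_time w (fst k) (snd k) < mark_time w (fst k) (n (fst k))"
          using n[of "fst k"] m by (auto simp: mark_at_def)
        then have "snd k < n (fst k)" using strict_mono_less[OF sm] by simp
        with k show "k \<in> (SIGMA x:E. {..<n x})" by (cases k) auto
      qed
      then show "finite {k \<in> E \<times> UNIV. mark_at w k \<le> t}"
        using E by (rule_tac finite_subset) auto
    qed
  qed
qed

text \<open>Events described through \<open>tau\<close> or \<open>Ncoll\<close> are handled by a
  measurable event that agrees with them almost surely; the completion then contains them with the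
  same probability.\<close>

lemma sets_completion_AE_eq:
  assumes A': "A' \<in> sets M" and A: "A \<subseteq> space M" and AE: "AE w in M. w \<in> A \<longleftrightarrow> w \<in> A'"
  shows "A \<in> sets (completion M)" "measure (completion M) A = measure M A'"
proof -
  show *: "A \<in> sets (completion M)"
  proof -
    obtain Z where Z: "Z \<in> null_sets M" "{w \<in> space M. \<not> (w \<in> A \<longleftrightarrow> w \<in> A')} \<subseteq> Z"
      using AE by (auto simp: eventually_ae_filter)
    show ?thesis
    proof (rule sets_completionI[of A "A' - Z" "A \<inter> Z" Z])
      show "A = A' - Z \<union> A \<inter> Z" using Z(2) A sets.sets_into_space[OF A'] by blast
    qed (use Z A' in auto)
  qed
  have "AE w in completion M. w \<in> A \<longleftrightarrow> w \<in> A'" using AE by (rule AE_completion)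
  then have "measure (completion M) A = measure (completion M) A'"
    using * A' by (intro measure_eq_AE) auto
  then show "measure (completion M) A = measure M A'" using A' by simp
qed

text \<open>Monotone convergence in the cutoff: the supremum of the weights is a measurable version
  of \<open>q ^ Ncoll\<close> and inherits any bound uniform in \<open>n\<close>.\<close>

lemma Ncoll_weight_bound:
  assumes N: "N \<ge> 1" and q: "q \<ge> 0" and x: "x1 \<in> Lambda N" "x2 \<in> Lambda N"
    and le: "\<And>n. (\<integral>\<^sup>+w. weight q (inner_pairs N) n t x1 x2 w \<partial>P_eps N) \<le> G"
  shows "\<exists>Z\<in>borel_measurable (P_eps N). (AE w in P_eps N. Z w = ennreal (q ^ Ncoll w N x1 x2 t)) \<and>
    (\<integral>\<^sup>+w. Z w \<partial>P_eps N) \<le> G"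
proof -
  let ?W = "\<lambda>n. weight q (inner_pairs N) n t x1 x2"
  have reg: "AE w in P_eps N. regular (inner_pairs N) w" by (rule AE_regular[OF N]) simp
  have Wm[measurable]: "?W n \<in> borel_measurable (P_eps N)" for n
    using measurable_weight[OF finite_inner_pairs, of "\<lambda>_. t" "P_eps N" "\<lambda>w. w"] by simp
  show ?thesis
  proof (intro bexI[of _ "\<lambda>w. SUP n. ?W n w"] conjI)
    show "(\<lambda>w. SUP n. ?W n w) \<in> borel_measurable (P_eps N)" by measurable
    show "AE w in P_eps N. (SUP n. ?W n w) = ennreal (q ^ Ncoll w N x1 x2 t)"
      using reg
    proof eventually_elim
      case (elim w)
      have W: "?W n w = (if card {k \<in> inner_pairs N \<times> UNIV. mark_at w k \<le> t} < n then ennreal (q ^ Ncoll w N x1 x2 t) else 0)" for n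
        by (rule weight_eq_Ncoll[OF N q elim x])
      show ?case
      proof (rule antisym)
        show "(SUP n. ?W n w) \<le> ennreal (q ^ Ncoll w N x1 x2 t)" by (rule SUP_least) (simp add: W)
        \<comment> \<open>The supremum is attained once the cutoff exceeds the number of marks up to
          \<open>t\<close>.\<close>
        show "ennreal (q ^ Ncoll w N x1 x2 t) \<le> (SUP n. ?W n w)"
          by (rule SUP_upper2[of "Suc (card {k \<in> inner_pairs N \<times> UNIV. mark_at w k \<le> t})"]) (simp_all only: W UNIV_I lessI if_True order_refl)
      qed
    qed
    have "(\<integral>\<^sup>+w. (SUP n. ?W n w) \<partial>P_eps N) = (SUP n. integral\<^sup>N (P_eps N) (?W n))"
    proof (rule nn_integral_monotone_convergence_SUP_AE)
      fix n
      show "AE w in P_eps N. ?W n w \<le> ?W (Suc n) w"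
        using reg
      proof eventually_elim
        case (elim w)
        show ?case by (simp only: weight_eq_Ncoll[OF N q elim x]) auto
      qed
    qed measurable
    also have "\<dots> \<le> G" by (rule SUP_least) (rule le)
    finally show "(\<integral>\<^sup>+w. (SUP n. ?W n w) \<partial>P_eps N) \<le> G" .
  qed
qed

text \<open>The left side admits a collision exactly at \<open>t\<close>, which \<open>Ncoll\<close>
  would count; the hypothesis that no mark falls at \<open>t\<close> removes this
  difference.\<close>

lemma le_tau_iff:
  assumes reg: "regular (inner_pairs N) w" and x: "x1 \<in> Lambda N" "x2 \<in> Lambda N"
    and t: "\<And>k. mark_at w k \<noteq> t"
  shows "ereal t \<le> tau w N x1 x2 \<longleftrightarrow> Ncoll w N x1 x2 t = 0"
proof -
  have mp: "\<forall>k\<in>inner_pairs N \<times> UNIV. 0 < mark_at w k" using regular_mark_at_pos[OF reg] by blast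
  note C = coll_times_alt[OF x mp]
  have C2: "coll_times w N x1 x2 \<subseteq> mark_at w ` (inner_pairs N \<times> UNIV)" unfolding C by blast
  have "{s \<in> coll_times w N x1 x2. s \<le> t} \<subseteq> mark_at w ` {k \<in> inner_pairs N \<times> UNIV. mark_at w k \<le> t}"
    using C2 by auto
  then have fin: "finite {s \<in> coll_times w N x1 x2. s \<le> t}"
    using reg by (rule_tac finite_subset) (auto simp: regular_def)
  have "ereal t \<le> tau w N x1 x2 \<longleftrightarrow> (\<forall>s\<in>coll_times w N x1 x2. t \<le> s)"
    by (simp add: tau_def le_Inf_iff)
  also have "\<dots> \<longleftrightarrow> {s \<in> coll_times w N x1 x2. s \<le> t} = {}"
  proof -
    have "t \<notin> coll_times w N x1 x2" using C2 t by auto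
    then show ?thesis by force
  qed
  also have "\<dots> \<longleftrightarrow> Ncoll w N x1 x2 t = 0"
    unfolding Ncoll_def using fin by (simp only: card_0_eq)
  finally show ?thesis .
qed

section \<open>Supersolutions for two stirring particles\<close>

lemma inner_pairs_eq: "inner_pairs N = {- int N..<int N}"
  by (auto simp: inner_pairs_def Lambda_def)

text \<open>For \<open>q = 1\<close>, subtracting \<open>card (inner_pairs N) * V x y\<close> leaves
  the generator of two stirring particles divided by \<open>(real N)\<^sup>2\<close>; other
  \<open>q\<close> add a Feynman-Kac weight at collisions.\<close>

definition pair_sum :: "nat \<Rightarrow> real \<Rightarrow> (int \<Rightarrow> int \<Rightarrow> real) \<Rightarrow> int \<Rightarrow> int \<Rightarrow> real" where
  "pair_sum N q V x y = (\<Sum>e\<in>inner_pairs N. coll_weight q e x y * (V (swp e x) (swp e y) + V x y) / 2)"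

lemma pair_sum_swap:
  assumes "\<And>x y. V x y = V y x" shows "pair_sum N q V x y = pair_sum N q V y x"
  unfolding pair_sum_def coll_weight_def using assms by (simp add: insert_commute)

text \<open>Only marks at \<open>x - 1\<close>, \<open>x\<close>, \<open>y - 1\<close> and
  \<open>y\<close> touch a particle. The outer two drop out at the walls; the inner two coincide
  when the particles are adjacent, and then the swap exchanges them with weight
  \<open>q\<close>.\<close>

lemma pair_sum_eq:
  fixes V :: "int \<Rightarrow> int \<Rightarrow> real"
  assumes xy: "x \<in> Lambda N" "y \<in> Lambda N" "x < y"
  shows "pair_sum N q V x y - card (inner_pairs N) * V x y =
    (if - int N < x then (V (x - 1) y - V x y) / 2 else 0) +
    (if y < int N then (V x (y + 1) - V x y) / 2 else 0) +
    (if y = x + 1 then q * (V y x + V x y) / 2 - V x y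
     else (V (x + 1) y - V x y) / 2 + (V x (y - 1) - V x y) / 2)"
proof -
  let ?E = "inner_pairs N" and ?F = "{x - 1, x, y - 1, y}"
  define f where "f e = coll_weight q e x y * (V (swp e x) (swp e y) + V x y) / 2 - V x y" for e
  have f0: "f e = 0" if "e \<notin> ?F" for e
  proof -
    have "swp e x = x" "swp e y = y" using that by (auto simp: swp_def)
    moreover have "{x, y} \<noteq> {e, e + 1}" using that by (auto simp: doubleton_eq_iff)
    ultimately show ?thesis by (simp add: f_def coll_weight_def)
  qed
  have "pair_sum N q V x y - card ?E * V x y = (\<Sum>e\<in>?E. f e)"
    by (simp add: pair_sum_def f_def sum_subtractf)
  also have "\<dots> = (\<Sum>e\<in>?E \<inter> ?F. f e)"
    by (rule sum.mono_neutral_right) (use f0 in auto)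
  also have "?E \<inter> ?F = {e \<in> ?F. e \<in> ?E}" by blast
  also have "(\<Sum>e\<in>{e \<in> ?F. e \<in> ?E}. f e) = (\<Sum>e\<in>?F. if e \<in> ?E then f e else 0)"
    by (rule sum.inter_filter) simp
  also have "\<dots> = (if - int N < x then (V (x - 1) y - V x y) / 2 else 0) +
    (if y < int N then (V x (y + 1) - V x y) / 2 else 0) +
    (if y = x + 1 then q * (V y x + V x y) / 2 - V x y
     else (V (x + 1) y - V x y) / 2 + (V x (y - 1) - V x y) / 2)"
  proof -
    have in1: "x - 1 \<in> ?E \<longleftrightarrow> - int N < x" "x \<in> ?E" "y - 1 \<in> ?E" "y \<in> ?E \<longleftrightarrow> y < int N"
      using xy by (auto simp: inner_pairs_eq Lambda_def)
    have v1: "f (x - 1) = (V (x - 1) y - V x y) / 2"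
      using xy(3) by (auto simp: f_def coll_weight_def swp_def doubleton_eq_iff field_simps)
    have v2: "f y = (V x (y + 1) - V x y) / 2"
      using xy(3) by (auto simp: f_def coll_weight_def swp_def doubleton_eq_iff field_simps)
    show ?thesis
    proof (cases "y = x + 1")
      case True
      have v3: "f x = q * (V y x + V x y) / 2 - V x y"
        using True by (simp add: f_def coll_weight_def swp_def)
      have F: "?F = {x - 1, x, y}" using True by auto
      have "(\<Sum>e\<in>?F. if e \<in> ?E then f e else 0) = (if - int N < x then f (x - 1) else 0) + (f x + (if y < int N then f y else 0))"
        unfolding F using True in1 by simp
      with True show ?thesis unfolding v1 v2 v3 by simp
    next
      case False
      have v3: "f x = (V (x + 1) y - V x y) / 2" "f (y - 1) = (V x (y - 1) - V x y) / 2"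
        using False xy(3) by (auto simp: f_def coll_weight_def swp_def doubleton_eq_iff field_simps)
      have "(\<Sum>e\<in>?F. if e \<in> ?E then f e else 0) = (if - int N < x then f (x - 1) else 0) + (f x + (f (y - 1) + (if y < int N then f y else 0)))"
        using False xy(3) in1 by simp
      with False show ?thesis unfolding v1 v2 v3 by simp
    qed
  qed
  finally show ?thesis .
qed

lemma swp_neq: "x \<noteq> y \<Longrightarrow> swp e x \<noteq> swp e y"
  by (auto simp: swp_def split: if_splits)

lemma dist_swp_le: "\<bar>swp e x - swp e y\<bar> \<le> \<bar>x - y\<bar> + 1"
  by (auto simp: swp_def)

text \<open>The profile \<open>d * (2 * R - d)\<close> has second difference -2 and increases up to
  \<open>R\<close>, so suppressing an outward jump at a wall only lowers the sum.\<close>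

lemma pair_sum_quadratic_le:
  fixes A k R :: real and V :: "int \<Rightarrow> int \<Rightarrow> real"
  defines "V \<equiv> \<lambda>x y. A + k * (real_of_int \<bar>x - y\<bar> * (2 * R - real_of_int \<bar>x - y\<bar>))"
  assumes xy: "x \<in> Lambda N" "y \<in> Lambda N" "x \<noteq> y" and R: "real_of_int \<bar>x - y\<bar> + 1 \<le> R" and A: "A \<ge> 0" and k: "k \<ge> 0"
  shows "pair_sum N 0 V x y \<le> card (inner_pairs N) * V x y - 2 * k"
proof -
  have *: "pair_sum N 0 V x y \<le> card (inner_pairs N) * V x y - 2 * k"
    if xy: "x \<in> Lambda N" "y \<in> Lambda N" "x < y" and R: "real_of_int \<bar>x - y\<bar> + 1 \<le> R" for x y
  proof -
    define D where "D = real_of_int (y - x)"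
    define G where "G d = A + k * (d * (2 * R - d))" for d
    have D: "D \<ge> 1" "D + 1 \<le> R" using xy R by (auto simp: D_def)
    have VG: "V u v = G (real_of_int (v - u))" if "u \<le> v" for u v
      using that by (simp add: V_def G_def)
    have V: "V x y = G D" "V y x = G D" "V (x - 1) y = G (D + 1)" "V x (y + 1) = G (D + 1)"
      "V (x + 1) y = G (D - 1)" "V x (y - 1) = G (D - 1)"
      using VG[of x y] VG[of "x - 1" y] VG[of x "y + 1"] VG[of "x + 1" y] VG[of x "y - 1"] xy(3)
      by (simp_all add: D_def algebra_simps) (simp add: V_def G_def)
    have up: "0 \<le> (G (D + 1) - G D) / 2"
    proof -
      have "G (D + 1) - G D = k * (2 * R - 2 * D - 1)" by (simp add: G_def algebra_simps)
      then show ?thesis using D k by simp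
    qed
    \<comment> \<open>At distance 1 killing puts 0 in place of the inward value
      \<open>G 0 = A\<close>, which is nonnegative.\<close>
    have main: "G (D + 1) - G D + (if y = x + 1 then - G D else G (D - 1) - G D) \<le> - 2 * k"
    proof (cases "y = x + 1")
      case True
      then have "D = 1" by (simp add: D_def)
      then show ?thesis using True A by (simp add: G_def algebra_simps)
    next
      case False
      then show ?thesis by (simp add: G_def algebra_simps)
    qed
    have "pair_sum N 0 V x y - card (inner_pairs N) * V x y \<le> (G (D + 1) - G D) / 2 + (G (D + 1) - G D) / 2 +
       (if y = x + 1 then - G D else (G (D - 1) - G D) / 2 + (G (D - 1) - G D) / 2)"
      unfolding pair_sum_eq[OF xy] unfolding V using up by (intro add_mono) auto
    with main show ?thesis by (auto split: if_splits)
  qed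
  show ?thesis
  proof (cases "x < y")
    case True then show ?thesis using * xy R by blast
  next
    case False
    have "V x y = V y x" for x y by (simp add: V_def abs_minus_commute)
    then have "pair_sum N 0 V x y = pair_sum N 0 V y x" "V x y = V y x" by (auto intro: pair_sum_swap)
    then show ?thesis using *[of y x] False xy R by (simp add: abs_minus_commute)
  qed
qed

text \<open>Away from walls and contact, \<open>exp (- a * D)\<close> and \<open>psi\<close> are
  eigenfunctions of the second difference, with a common eigenvalue of order
  \<open>a\<^sup>2\<close>. At a wall the lost outward jump costs at most \<open>a / 2\<close>,
  which the increment of \<open>B * psi\<close> repays; at contact the gain from \<open>q\<close> is
  paid by the drop of \<open>exp (- a * D)\<close> from distance 1 to 2. The summand 1 gives
  \<open>V\<close> at least 1, the initial condition of a supersolution.\<close>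

lemma pair_sum_exp_le:
  fixes a B q :: real and N :: nat and psi :: "int \<Rightarrow> real" and V :: "int \<Rightarrow> int \<Rightarrow> real"
  defines "psi \<equiv> \<lambda>x::int. exp (a * (real_of_int x - real N)) + exp (- a * (real_of_int x + real N))"
  defines "V \<equiv> \<lambda>x y. 1 + exp (- a * real_of_int \<bar>x - y\<bar>) + B * (psi x + psi y)"
  assumes xy: "x \<in> Lambda N" "y \<in> Lambda N" "x \<noteq> y" and a: "0 < a" "a \<le> 1" and B: "0 \<le> B" "1 \<le> B * (1 - exp (- 2 * a * N))"
    and q: "1 \<le> q" "(q - 1) * (2 + 4 * B) \<le> exp (- a) - exp (- 2 * a)"
  shows "pair_sum N q V x y \<le> (card (inner_pairs N) + 2 * a\<^sup>2) * V x y"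
    and "1 \<le> V x y" "V x y \<le> 2 + 4 * B"
proof -
  define c where "c = exp a + exp (- a) - 2"
  have psi0: "0 \<le> psi z" for z by (simp add: psi_def)
  have V1: "1 \<le> V x y" for x y using B(1) psi0 by (simp add: V_def)
  show "1 \<le> V x y" by (rule V1)
  have psi2: "psi z \<le> 2" if "z \<in> Lambda N" for z
  proof -
    have "a * (real_of_int z - real N) \<le> 0" "- a * (real_of_int z + real N) \<le> 0" using that a by (auto simp: Lambda_def mult_le_0_iff)
    then have "exp (a * (real_of_int z - real N)) \<le> 1" "exp (- a * (real_of_int z + real N)) \<le> 1" by simp_all
    then show ?thesis unfolding psi_def by linarith
  qed
  have V2: "V x y \<le> 2 + 4 * B" if "x \<in> Lambda N" "y \<in> Lambda N" for x y
  proof -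
    have "B * (psi x + psi y) \<le> B * 4" using psi2[OF that(1)] psi2[OF that(2)] B(1) by (intro mult_left_mono) auto
    moreover have "exp (- a * real_of_int \<bar>x - y\<bar>) \<le> 1" using a by simp
    ultimately show ?thesis unfolding V_def by linarith
  qed
  show "V x y \<le> 2 + 4 * B" using V2 xy by blast
  have c0: "0 \<le> c"
    using exp_ge_add_one_self[of a] exp_ge_add_one_self[of "- a"] unfolding c_def by linarith
  have c2: "c \<le> 2 * a\<^sup>2"
  proof -
    have "exp a \<le> 1 + a + a\<^sup>2" using a by (intro exp_bound) auto
    moreover have "exp (- a) \<le> 1 - a + a\<^sup>2"
    proof -
      \<comment> \<open>The product equals \<open>1 + a ^ 3\<close>.\<close>
      have "1 \<le> (1 - a + a\<^sup>2) * (1 + a)" using a by (simp add: algebra_simps power2_eq_square)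
      also have "\<dots> \<le> (1 - a + a\<^sup>2) * exp a"
        using exp_ge_add_one_self[of a] a by (intro mult_left_mono) (auto intro: add_nonneg_nonneg)
      finally show ?thesis by (simp add: exp_minus field_simps)
    qed
    ultimately show ?thesis by (simp add: c_def)
  qed
  have ea: "a \<le> exp a - 1" "0 \<le> 1 - exp (- a)" "1 - exp (- a) \<le> a" "1 - exp (- a) \<le> exp a - 1"
  proof -
    have "exp (- a) \<le> 1" using a by simp
    then show "a \<le> exp a - 1" "0 \<le> 1 - exp (- a)" "1 - exp (- a) \<le> a" "1 - exp (- a) \<le> exp a - 1"
      using exp_ge_add_one_self[of a] exp_ge_add_one_self[of "- a"] c0 unfolding c_def by linarith+
  qed
  have psi_c: "psi (z + 1) + psi (z - 1) - 2 * psi z = c * psi z" for z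
  proof -
    have "exp (a * (real_of_int (z + 1) - N)) = exp (a * (real_of_int z - real N)) * exp a" "exp (- a * (real_of_int (z + 1) + N)) = exp (- a * (real_of_int z + real N)) * exp (- a)"
      "exp (a * (real_of_int (z - 1) - N)) = exp (a * (real_of_int z - real N)) * exp (- a)" "exp (- a * (real_of_int (z - 1) + N)) = exp (- a * (real_of_int z + real N)) * exp a"
      by (simp_all add: algebra_simps flip: exp_add)
    then show ?thesis unfolding psi_def c_def by (simp add: algebra_simps)
  qed
  \<comment> \<open>The bracket is the outward increment of \<open>psi\<close> at either wall; the
    lower bound on \<open>B\<close> makes \<open>B\<close> times it at least
    \<open>a\<close>.\<close>
  have bdry: "a \<le> B * ((exp a - 1) - exp (- 2 * a * N) * (1 - exp (- a)))"
  proof -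
    have "a * 1 \<le> (exp a - 1) * (B * (1 - exp (- 2 * a * N)))"
      using ea(1) a B(2) by (intro mult_mono) auto
    also have "\<dots> = B * ((exp a - 1) - exp (- 2 * a * N) * (exp a - 1))" by (simp add: algebra_simps)
    also have "\<dots> \<le> B * ((exp a - 1) - exp (- 2 * a * N) * (1 - exp (- a)))"
      using ea(4) B(1) by (intro mult_left_mono diff_left_mono) auto
    finally show ?thesis by simp
  qed
  have psiL: "a \<le> B * (psi (- int N - 1) - psi (- int N))"
    using bdry by (simp add: psi_def algebra_simps flip: exp_add)
  have psiR: "a \<le> B * (psi (int N + 1) - psi (int N))"
    using bdry by (simp add: psi_def algebra_simps flip: exp_add)
  have *: "pair_sum N q V x y \<le> (card (inner_pairs N) + 2 * a\<^sup>2) * V x y"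
    if xy: "x \<in> Lambda N" "y \<in> Lambda N" "x < y" for x y
  proof -
    define D where "D = real_of_int (y - x)"
    define G where "G d = exp (- a * d)" for d :: real
    have D: "D \<ge> 1" using xy by (simp add: D_def)
    have V: "V x y = 1 + G D + B * (psi x + psi y)" "V y x = 1 + G D + B * (psi x + psi y)"
      "V (x - 1) y = 1 + G (D + 1) + B * (psi (x - 1) + psi y)" "V x (y + 1) = 1 + G (D + 1) + B * (psi x + psi (y + 1))"
      "V (x + 1) y = 1 + G (D - 1) + B * (psi (x + 1) + psi y)" "V x (y - 1) = 1 + G (D - 1) + B * (psi x + psi (y - 1))"
      using xy(3) by (simp_all add: V_def G_def D_def algebra_simps)
    have Gc: "G (D + 1) + G (D - 1) - 2 * G D = c * G D"
      by (simp add: G_def c_def algebra_simps flip: exp_add)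
    have Gb: "G D - G (D + 1) \<le> a"
    proof -
      have "G D - G (D + 1) = G D * (1 - exp (- a))" by (simp add: G_def algebra_simps flip: exp_add)
      also have "\<dots> \<le> 1 * a" using ea(2,3) a D by (intro mult_mono) (auto simp: G_def)
      finally show ?thesis by simp
    qed
    have half: "0 \<le> (v - u) / 2 + z / 2" if "u - v \<le> a" "a \<le> z" for u v z :: real
      using that by (simp add: field_simps)
    have left: "(if - int N < x then (V (x - 1) y - V x y) / 2 else 0) \<le> (G (D + 1) - G D) / 2 + B * (psi (x - 1) - psi x) / 2"
    proof (cases "- int N < x")
      case True then show ?thesis unfolding V by (simp add: field_simps)
    next
      case False
      then have "x = - int N" using xy by (simp add: Lambda_def)
      then have "a \<le> B * (psi (x - 1) - psi x)" using psiL by simp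
      then show ?thesis unfolding if_not_P[OF False] by (rule half[OF Gb])
    qed
    have right: "(if y < int N then (V x (y + 1) - V x y) / 2 else 0) \<le> (G (D + 1) - G D) / 2 + B * (psi (y + 1) - psi y) / 2"
    proof (cases "y < int N")
      case True then show ?thesis unfolding V by (simp add: field_simps)
    next
      case False
      then have "y = int N" using xy by (simp add: Lambda_def)
      then have "a \<le> B * (psi (y + 1) - psi y)" using psiR by simp
      then show ?thesis unfolding if_not_P[OF False] by (rule half[OF Gb])
    qed
    have mid: "(if y = x + 1 then q * (V y x + V x y) / 2 - V x y
     else (V (x + 1) y - V x y) / 2 + (V x (y - 1) - V x y) / 2) + (G (D + 1) - G D) \<le>
      c * G D + B * (psi (x + 1) - psi x) / 2 + B * (psi (y - 1) - psi y) / 2"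
    proof (cases "y = x + 1")
      case True
      then have "D = 1" by (simp add: D_def)
      then have G: "G (D + 1) - G D = exp (- 2 * a) - exp (- a)" by (simp add: G_def)
      have "q * (V y x + V x y) / 2 - V x y = (q - 1) * V x y" unfolding V by (simp add: field_simps)
      also have "\<dots> \<le> (q - 1) * (2 + 4 * B)" using V2[OF xy(1,2)] q(1) by (intro mult_left_mono) auto
      finally have "q * (V y x + V x y) / 2 - V x y \<le> exp (- a) - exp (- 2 * a)" using q(2) by linarith
      \<comment> \<open>For neighbours each particle would move to the site of the other, so the two
        increments cancel.\<close>
      moreover have "B * (psi (x + 1) - psi x) / 2 + B * (psi (y - 1) - psi y) / 2 = 0" using True by (simp add: field_simps)
      moreover have "0 \<le> c * G D" using c0 by (simp add: G_def)
      ultimately show ?thesis using True G by auto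
    next
      case False
      then show ?thesis unfolding V using Gc by (simp add: field_simps)
    qed
    have "pair_sum N q V x y - card (inner_pairs N) * V x y \<le>
      c * G D + B * (psi (x + 1) + psi (x - 1) - 2 * psi x) / 2 + B * (psi (y + 1) + psi (y - 1) - 2 * psi y) / 2"
      unfolding pair_sum_eq[OF xy] using left right mid by (simp add: field_simps)
    also have "\<dots> = c * (G D + B * (psi x + psi y) / 2)"
      unfolding psi_c by (simp add: field_simps)
    also have "\<dots> \<le> (2 * a\<^sup>2) * V x y"
    proof (rule mult_mono[OF c2])
      have "0 \<le> B * (psi x + psi y)" using B(1) psi0 by simp
      then show "G D + B * (psi x + psi y) / 2 \<le> V x y" "0 \<le> G D + B * (psi x + psi y) / 2" unfolding V by (auto simp: G_def)
    qed simp
    finally show ?thesis by (simp add: algebra_simps)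
  qed
  show "pair_sum N q V x y \<le> (card (inner_pairs N) + 2 * a\<^sup>2) * V x y"
  proof (cases "x < y")
    case True then show ?thesis using * xy by blast
  next
    case False
    have "V x y = V y x" for x y by (simp add: V_def abs_minus_commute add.commute)
    then have "pair_sum N q V x y = pair_sum N q V y x" "V x y = V y x" by (auto intro: pair_sum_swap)
    then show ?thesis using *[of y x] False xy by simp
  qed
qed

section \<open>Tail bounds\<close>

lemma swp_pair_cases:
  assumes "x \<in> Lambda N" "y \<in> Lambda N" "x \<noteq> y" "e \<in> inner_pairs N"
  shows "swp e x \<in> Lambda N" "swp e y \<in> Lambda N" "swp e x \<noteq> swp e y"
  using assms swp_Lambda swp_neq by auto

text \<open>For such \<open>q\<close> the constant 1 is a supersolution. This serves for short times
  and on the edge of the region where the quadratic profile is used.\<close>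

lemma nn_integral_weight_le_1:
  assumes N: "N \<ge> 1" and q: "0 \<le> q" "q \<le> 1" and t: "0 \<le> t"
  shows "(\<integral>\<^sup>+w. weight q (inner_pairs N) n t x y w \<partial>P_eps N) \<le> 1"
  using t
proof (induction n arbitrary: t x y)
  case 0
  then show ?case by simp
next
  case (Suc n)
  have "(\<integral>\<^sup>+w. weight q (inner_pairs N) (Suc n) t x y w \<partial>P_eps N) \<le> ennreal ((\<lambda>_ _ _. 1) t x y)"
  proof (rule nn_integral_weight_Suc_le[where g'="\<lambda>_. 0"])
    have "(\<Sum>e\<in>inner_pairs N. coll_weight q e x y * (1 + 1) / 2) \<le> (\<Sum>e\<in>inner_pairs N. 1)"
      using q by (intro sum_mono) (simp add: coll_weight_def)
    then show "(real N)\<^sup>2 * (\<Sum>e\<in>inner_pairs N. coll_weight q e x y * (1 + 1) / 2) \<le> (real N)\<^sup>2 * card (inner_pairs N) * 1 + 0"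
      by (simp add: mult_left_mono mult.assoc)
  qed (use N q Suc in auto)
  then show ?case by simp
qed

text \<open>The comparison runs on distances up to \<open>R\<close>. At distance \<open>R\<close>
  the right side is at least 1 by the size of \<open>R\<close>; below it, one mark changes the
  distance by at most 1 and so stays in the region.\<close>

lemma nn_integral_weight_0_le:
  fixes R :: nat
  assumes N: "N \<ge> 1" and t0: "0 < t0" and R: "2 * ((real N)\<^sup>2 * t0) \<le> (real R)\<^sup>2"
    and t: "0 \<le> t" "t \<le> t0" and xy: "x \<in> Lambda N" "y \<in> Lambda N" "x \<noteq> y" "\<bar>x - y\<bar> \<le> int R"
  shows "(\<integral>\<^sup>+w. weight 0 (inner_pairs N) n t x y w \<partial>P_eps N) \<le>
    ennreal (1 - t / t0 + 1 / (2 * ((real N)\<^sup>2 * t0)) * (real_of_int \<bar>x - y\<bar> * (2 * real R - real_of_int \<bar>x - y\<bar>)))"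
  using t xy
proof (induction n arbitrary: t x y)
  case 0
  then show ?case by simp
next
  case (Suc n)
  \<comment> \<open>With this \<open>k\<close> the decrease \<open>2 * k\<close> at rate
    \<open>(real N)\<^sup>2\<close> equals \<open>1 / t0\<close> and balances the time derivative
    \<open>- 1 / t0\<close>.\<close>
  define k where "k = 1 / (2 * ((real N)\<^sup>2 * t0))"
  define g where "g t x y = 1 - t / t0 + k * (real_of_int \<bar>x - y\<bar> * (2 * real R - real_of_int \<bar>x - y\<bar>))" for t x y
  have k: "k \<ge> 0" "(real N)\<^sup>2 * (2 * k) = 1 / t0" using N t0 by (auto simp: k_def)
  have IH: "(\<integral>\<^sup>+w. weight 0 (inner_pairs N) n s x y w \<partial>P_eps N) \<le> ennreal (g s x y)"
    if "0 \<le> s" "s \<le> t0" "x \<in> Lambda N" "y \<in> Lambda N" "x \<noteq> y" "\<bar>x - y\<bar> \<le> int R" for s x y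
    unfolding g_def k_def by (rule Suc.IH) (use that in auto)
  have g0: "0 \<le> g s x y" if "0 \<le> s" "s \<le> t0" "\<bar>x - y\<bar> \<le> int R" for s x y
  proof -
    have "real_of_int \<bar>x - y\<bar> \<le> real R" using that(3) by (metis of_int_le_iff of_int_of_nat_eq)
    then have "0 \<le> real_of_int \<bar>x - y\<bar> * (2 * real R - real_of_int \<bar>x - y\<bar>)" by (intro mult_nonneg_nonneg) auto
    moreover have "s / t0 \<le> 1" using that t0 by simp
    ultimately show ?thesis using k by (simp add: g_def)
  qed
  show ?case
  proof (cases "\<bar>x - y\<bar> = int R")
    case True
    have "(\<integral>\<^sup>+w. weight 0 (inner_pairs N) (Suc n) t x y w \<partial>P_eps N) \<le> 1"
      by (rule nn_integral_weight_le_1[OF N]) (use Suc in auto)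
    also have "1 \<le> ennreal (g t x y)"
    proof -
      have "real_of_int \<bar>x - y\<bar> = real R" using True by simp
      then have "g t x y = 1 - t / t0 + k * (real R)\<^sup>2" by (simp add: g_def power2_eq_square)
      moreover have "1 \<le> k * (real R)\<^sup>2" using R N t0 by (simp add: k_def field_simps)
      moreover have "t / t0 \<le> 1" using Suc.prems t0 by simp
      ultimately have "1 \<le> g t x y" by linarith
      then show ?thesis by simp
    qed
    finally show ?thesis by (simp only: g_def k_def)
  next
    case False
    then have R1: "\<bar>x - y\<bar> + 1 \<le> int R" using Suc.prems by simp
    have R2: "\<bar>swp e x - swp e y\<bar> \<le> int R" for e using dist_swp_le[of e x y] R1 by linarith
    have "(\<integral>\<^sup>+w. weight 0 (inner_pairs N) (Suc n) t x y w \<partial>P_eps N) \<le> ennreal (g t x y)"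
    proof (rule nn_integral_weight_Suc_le[where g=g and g'="\<lambda>_. - 1 / t0"])
      fix s assume s: "0 \<le> s" "s \<le> t"
      then have s0: "s \<le> t0" using Suc.prems by simp
      show "(\<integral>\<^sup>+w. weight 0 (inner_pairs N) n s x y w \<partial>P_eps N) \<le> ennreal (g s x y)"
        using s s0 Suc.prems by (intro IH) auto
      show "0 \<le> g s x y" using s s0 Suc.prems by (intro g0) auto
      show "(\<integral>\<^sup>+w. weight 0 (inner_pairs N) n s (swp e x) (swp e y) w \<partial>P_eps N) \<le> ennreal (g s (swp e x) (swp e y))"
        if "e \<in> inner_pairs N" for e
        using s s0 Suc.prems swp_pair_cases[OF Suc.prems(3-5) that] R2 by (intro IH) auto
      show "0 \<le> g s (swp e x) (swp e y)" for e using s s0 R2 by (intro g0) auto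
      have "pair_sum N 0 (g s) x y \<le> card (inner_pairs N) * g s x y - 2 * k"
        unfolding g_def
      proof (rule pair_sum_quadratic_le)
        have "real_of_int (\<bar>x - y\<bar> + 1) \<le> real_of_int (int R)" using R1 by (simp only: of_int_le_iff)
        then show "real_of_int \<bar>x - y\<bar> + 1 \<le> real R" by simp
        show "0 \<le> 1 - s / t0" using s0 t0 by simp
      qed (use Suc.prems k in auto)
      then have "(real N)\<^sup>2 * pair_sum N 0 (g s) x y \<le> (real N)\<^sup>2 * (card (inner_pairs N) * g s x y - 2 * k)"
        by (rule mult_left_mono) simp
      then show "(real N)\<^sup>2 * (\<Sum>e\<in>inner_pairs N. coll_weight 0 e x y * (g s (swp e x) (swp e y) + g s x y) / 2)
        \<le> (real N)\<^sup>2 * card (inner_pairs N) * g s x y + - 1 / t0"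
        unfolding pair_sum_def using k by (simp add: right_diff_distrib mult.assoc)
    next
      show "1 \<le> g 0 x y"
      proof -
        have "real_of_int \<bar>x - y\<bar> \<le> real R" using Suc.prems(6) by (metis of_int_le_iff of_int_of_nat_eq)
        then have "0 \<le> real_of_int \<bar>x - y\<bar> * (2 * real R - real_of_int \<bar>x - y\<bar>)" by (intro mult_nonneg_nonneg) auto
        then show ?thesis using k by (simp add: g_def)
      qed
      show "((\<lambda>s. g s x y) has_real_derivative - 1 / t0) (at s)" for s
        unfolding g_def using t0 by (auto intro!: derivative_eq_intros simp: field_simps)
    qed (use N Suc.prems in auto)
    then show ?thesis by (simp only: g_def k_def)
  qed
qed

text \<open>The exponential in time absorbs the surplus \<open>2 * a\<^sup>2 * V x y\<close> of the
  spatial profile, turning it into a supersolution. The resulting bound is uniform in the starting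
  pair and in the cutoff.\<close>

lemma nn_integral_weight_exp_le:
  fixes a B q :: real and N :: nat
  assumes N: "N \<ge> 1" and t: "0 \<le> t" and xy: "x \<in> Lambda N" "y \<in> Lambda N" "x \<noteq> y"
    and a: "0 < a" "a \<le> 1" and B: "0 \<le> B" "1 \<le> B * (1 - exp (- 2 * a * N))"
    and q: "1 \<le> q" "(q - 1) * (2 + 4 * B) \<le> exp (- a) - exp (- 2 * a)"
  shows "(\<integral>\<^sup>+w. weight q (inner_pairs N) n t x y w \<partial>P_eps N) \<le> ennreal (exp (2 * a\<^sup>2 * (real N)\<^sup>2 * t) * (2 + 4 * B))"
proof -
  define psi where "psi x = exp (a * (real_of_int x - N)) + exp (- a * (real_of_int x + N))" for x
  define V where "V x y = 1 + exp (- a * real_of_int \<bar>x - y\<bar>) + B * (psi x + psi y)" for x y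
  define K where "K = 2 * a\<^sup>2 * (real N)\<^sup>2"
  define g where "g t x y = exp (K * t) * V x y" for t x y
  have Veq: "V = (\<lambda>x y. 1 + exp (- a * real_of_int \<bar>x - y\<bar>) +
      B * (exp (a * (real_of_int x - N)) + exp (- a * (real_of_int x + N)) + (exp (a * (real_of_int y - N)) + exp (- a * (real_of_int y + N)))))"
    by (simp add: V_def psi_def fun_eq_iff)
  have V: "pair_sum N q V x y \<le> (card (inner_pairs N) + 2 * a\<^sup>2) * V x y" "1 \<le> V x y" "V x y \<le> 2 + 4 * B"
    if "x \<in> Lambda N" "y \<in> Lambda N" "x \<noteq> y" for x y
    unfolding Veq by (rule pair_sum_exp_le[OF that a B q])+
  have "(\<integral>\<^sup>+w. weight q (inner_pairs N) n t x y w \<partial>P_eps N) \<le> ennreal (g t x y)"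
    using t xy
  proof (induction n arbitrary: t x y)
    case 0
    then show ?case by simp
  next
    case (Suc n)
    have g0: "0 \<le> g s x y" if "x \<in> Lambda N" "y \<in> Lambda N" "x \<noteq> y" for s x y
      using V(2)[OF that] by (simp add: g_def)
    show ?case
    proof (rule nn_integral_weight_Suc_le[where g=g and g'="\<lambda>s. K * g s x y"])
      fix s assume s: "0 \<le> s" "s \<le> t"
      show "(\<integral>\<^sup>+w. weight q (inner_pairs N) n s x y w \<partial>P_eps N) \<le> ennreal (g s x y)"
        using s Suc.prems by (intro Suc.IH) auto
      show "0 \<le> g s x y" using Suc.prems by (intro g0) auto
      show "(\<integral>\<^sup>+w. weight q (inner_pairs N) n s (swp e x) (swp e y) w \<partial>P_eps N) \<le> ennreal (g s (swp e x) (swp e y))"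
        "0 \<le> g s (swp e x) (swp e y)" if "e \<in> inner_pairs N" for e
        using s swp_pair_cases[OF Suc.prems(2-4) that] by (auto intro!: Suc.IH g0)
      have "(\<Sum>e\<in>inner_pairs N. coll_weight q e x y * (g s (swp e x) (swp e y) + g s x y) / 2) = exp (K * s) * pair_sum N q V x y"
        unfolding pair_sum_def g_def sum_distrib_left by (intro sum.cong refl) (simp add: field_simps)
      also have "\<dots> \<le> exp (K * s) * ((card (inner_pairs N) + 2 * a\<^sup>2) * V x y)"
        using V(1)[OF Suc.prems(2-4)] by (intro mult_left_mono) auto
      finally have "(real N)\<^sup>2 * (\<Sum>e\<in>inner_pairs N. coll_weight q e x y * (g s (swp e x) (swp e y) + g s x y) / 2)
        \<le> (real N)\<^sup>2 * (exp (K * s) * ((card (inner_pairs N) + 2 * a\<^sup>2) * V x y))"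
        by (rule mult_left_mono) simp
      also have "\<dots> = (real N)\<^sup>2 * card (inner_pairs N) * g s x y + K * g s x y"
        by (simp add: g_def K_def algebra_simps)
      finally show "(real N)\<^sup>2 * (\<Sum>e\<in>inner_pairs N. coll_weight q e x y * (g s (swp e x) (swp e y) + g s x y) / 2)
        \<le> (real N)\<^sup>2 * card (inner_pairs N) * g s x y + K * g s x y" .
    next
      show "1 \<le> g 0 x y" using V(2)[OF Suc.prems(2-4)] by (simp add: g_def)
      show "((\<lambda>s. g s x y) has_real_derivative K * g s x y) (at s)" for s
        unfolding g_def by (auto intro!: derivative_eq_intros)
      show "continuous_on UNIV (\<lambda>s. K * g s x y)"
        unfolding g_def by (intro continuous_intros)
    qed (use N Suc.prems q in auto)
  qed
  also have "\<dots> \<le> ennreal (exp (2 * a\<^sup>2 * (real N)\<^sup>2 * t) * (2 + 4 * B))"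
    unfolding g_def K_def using V(3)[OF xy] by (intro ennreal_leI mult_left_mono) auto
  finally show ?thesis .
qed

section \<open>Probabilities of events about the collision number\<close>

lemma Ncoll_event_measurable:
  fixes q c :: real
  assumes N: "N \<ge> 1" and q: "q \<ge> 0" and x: "x1 \<in> Lambda N" "x2 \<in> Lambda N"
    and A: "AE w in P_eps N. w \<in> A \<longleftrightarrow> c \<le> q ^ Ncoll w N x1 x2 t"
  shows "A \<in> sets (completion (P_eps N))"
proof -
  \<comment> \<open>Only the measurable version is wanted here, so the trivial bound by
    \<open>top\<close> is supplied.\<close>
  obtain Z where Z[measurable]: "Z \<in> borel_measurable (P_eps N)"
    and Zae: "AE w in P_eps N. Z w = ennreal (q ^ Ncoll w N x1 x2 t)"
    using Ncoll_weight_bound[OF N q x top_greatest] by blast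
  have A': "{w \<in> space (P_eps N). ennreal c \<le> Z w} \<in> sets (P_eps N)" by measurable
  have "AE w in P_eps N. w \<in> A \<longleftrightarrow> w \<in> {w \<in> space (P_eps N). ennreal c \<le> Z w}"
    using A Zae by eventually_elim (use q in \<open>simp add: ennreal_le_iff\<close>)
  from sets_completion_AE_eq(1)[OF A' _ this] show ?thesis by simp
qed

text \<open>Markov's inequality for the measurable version of \<open>q ^ Ncoll\<close>, carried over
  to the completion.\<close>

lemma Ncoll_prob_bound:
  fixes q c G :: real
  assumes N: "N \<ge> 1" and q: "q \<ge> 0" and x: "x1 \<in> Lambda N" "x2 \<in> Lambda N"
    and le: "\<And>n. (\<integral>\<^sup>+w. weight q (inner_pairs N) n t x1 x2 w \<partial>P_eps N) \<le> ennreal G"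
    and G: "0 \<le> G" and c: "0 < c"
    and A: "AE w in P_eps N. w \<in> A \<longleftrightarrow> c \<le> q ^ Ncoll w N x1 x2 t"
  shows "measure (completion (P_eps N)) A \<le> G / c"
proof -
  interpret P: prob_space "P_eps N" by (rule prob_space_P_eps[OF N])
  obtain Z where Z[measurable]: "Z \<in> borel_measurable (P_eps N)"
    and Zae: "AE w in P_eps N. Z w = ennreal (q ^ Ncoll w N x1 x2 t)" and Zi: "(\<integral>\<^sup>+w. Z w \<partial>P_eps N) \<le> ennreal G"
    using Ncoll_weight_bound[OF N q x le] by blast
  let ?A = "{w \<in> space (P_eps N). ennreal c \<le> Z w}"
  have A': "?A \<in> sets (P_eps N)" by measurable
  have AE: "AE w in P_eps N. w \<in> A \<longleftrightarrow> w \<in> ?A"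
    using A Zae by eventually_elim (use q in \<open>simp add: ennreal_le_iff\<close>)
  have m: "measure (completion (P_eps N)) A = measure (P_eps N) ?A"
    by (rule sets_completion_AE_eq(2)[OF A' _ AE]) simp
  have "ennreal c * emeasure (P_eps N) ?A = (\<integral>\<^sup>+w. ennreal c * indicator ?A w \<partial>P_eps N)"
    using A' by (simp add: nn_integral_cmult_indicator)
  also have "\<dots> \<le> (\<integral>\<^sup>+w. Z w \<partial>P_eps N)" by (intro nn_integral_mono) (auto simp: indicator_def)
  also have "\<dots> \<le> ennreal G" by (rule Zi)
  finally have "ennreal (c * measure (P_eps N) ?A) \<le> ennreal G"
    using c by (simp add: P.emeasure_eq_measure ennreal_mult')
  then have "c * measure (P_eps N) ?A \<le> G" using G by simp
  then show ?thesis unfolding m using c by (simp add: field_simps)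
qed

text \<open>Here \<open>q = 0\<close> and the threshold is 1, since \<open>0 ^ n\<close> is the
  indicator of \<open>n = 0\<close>. The supersolution is evaluated at distance 1 with
  \<open>t0 = t\<close>, where its part \<open>1 - t / t0\<close> vanishes.\<close>

lemma tau_bound:
  assumes N: "N \<ge> 1" and t: "0 \<le> t" and x: "x1 \<in> Lambda N" "x2 \<in> Lambda N" "\<bar>x1 - x2\<bar> = 1"
  defines "A \<equiv> {w \<in> space (P_eps N). ereal t \<le> tau w N x1 x2}"
  shows "A \<in> sets (completion (P_eps N)) \<and> measure (completion (P_eps N)) A \<le> 4 / (sqrt ((real N)\<^sup>2 * t) + 1)"
proof -
  have AE: "AE w in P_eps N. w \<in> A \<longleftrightarrow> 1 \<le> (0::real) ^ Ncoll w N x1 x2 t"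
  proof -
    have "AE w in P_eps N. \<forall>k. mark_at w k \<noteq> t"
      unfolding AE_all_countable using AE_mark_at_neq_const[OF N] by blast
    moreover have "AE w in P_eps N. regular (inner_pairs N) w" by (rule AE_regular[OF N]) simp
    ultimately show ?thesis
    proof eventually_elim
      case (elim w)
      then show ?case using le_tau_iff[OF elim(2) x(1,2), of t] by (auto simp: A_def power_0_left)
    qed
  qed
  define m where "m = (real N)\<^sup>2 * t"
  have neq: "x1 \<noteq> x2" using x(3) by auto
  have m0: "0 \<le> m" using t by (simp add: m_def)
  have "A \<in> sets (completion (P_eps N))"
    by (rule Ncoll_event_measurable[OF N order_refl x(1,2) AE])
  moreover have "measure (completion (P_eps N)) A \<le> 4 / (sqrt m + 1)"
  proof (cases "m < 1")
    \<comment> \<open>In this range the claimed bound is at least 1.\<close>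
    case True
    have le: "(\<integral>\<^sup>+w. weight 0 (inner_pairs N) n t x1 x2 w \<partial>P_eps N) \<le> ennreal 1" for n
      using nn_integral_weight_le_1[OF N, of 0 t] t by simp
    have s: "sqrt m + 1 \<le> 2" using True m0 by simp
    have "0 < sqrt m + 1" using m0 by (simp add: add_nonneg_pos)
    have "sqrt m + 1 \<le> 4" by (rule order_trans[OF s]) simp
    with \<open>0 < sqrt m + 1\<close> have "1 \<le> 4 / (sqrt m + 1)" by (simp only: le_divide_eq_1_pos)
    then show ?thesis
      using Ncoll_prob_bound[OF N order_refl x(1,2) le zero_le_one zero_less_one AE] by linarith
  next
    case False
    then have t0: "0 < t" using t by (cases "t = 0") (auto simp: m_def)
    define r where "r = sqrt m"
    have r: "1 \<le> r" "r\<^sup>2 = m" using False by (auto simp: r_def)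
    \<comment> \<open>The least natural number whose square is at least
      \<open>2 * m\<close>.\<close>
    define R where "R = nat \<lceil>sqrt (2 * m)\<rceil>"
    have R1: "sqrt (2 * m) \<le> real R" unfolding R_def by linarith
    have R2: "real R \<le> sqrt (2 * m) + 1"
      unfolding R_def using m0 by (simp add: of_nat_nat)
    have "(sqrt (2 * m))\<^sup>2 \<le> (real R)\<^sup>2" using R1 m0 by (intro power_mono) auto
    then have RR: "2 * ((real N)\<^sup>2 * t) \<le> (real R)\<^sup>2" using m0 by (simp add: m_def)
    have "1 \<le> sqrt (2 * m)" using False by simp
    with R1 have R3: "1 \<le> R" by linarith
    define G where "G = (2 * real R - 1) / (2 * m)"
    have le: "(\<integral>\<^sup>+w. weight 0 (inner_pairs N) n t x1 x2 w \<partial>P_eps N) \<le> ennreal G" for n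
    proof -
      have "(\<integral>\<^sup>+w. weight 0 (inner_pairs N) n t x1 x2 w \<partial>P_eps N) \<le>
        ennreal (1 - t / t + 1 / (2 * ((real N)\<^sup>2 * t)) * (real_of_int \<bar>x1 - x2\<bar> * (2 * real R - real_of_int \<bar>x1 - x2\<bar>)))"
        by (rule nn_integral_weight_0_le[OF N t0 RR t order_refl x(1,2) neq]) (use x(3) R3 in simp)
      also have "\<dots> = ennreal G" using t0 unfolding x(3) by (simp add: G_def m_def)
      finally show ?thesis .
    qed
    have G0: "0 \<le> G" using R3 m0 by (simp add: G_def)
    have "G \<le> 4 / (r + 1)"
    proof -
      have "sqrt (2 * m) = sqrt 2 * r" by (simp add: r_def real_sqrt_mult)
      \<comment> \<open>Bounding \<open>sqrt 2\<close> by \<open>3 / 2\<close> makes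
        \<open>2 * real R - 1\<close> at most \<open>4 * r\<close>, which leads to the constant
        4.\<close>
      also have "\<dots> \<le> 3 / 2 * r"
        using r(1) by (intro mult_right_mono real_le_lsqrt) (auto simp: power2_eq_square)
      finally have "2 * real R - 1 \<le> 3 * r + 1" using R2 by linarith
      also have "\<dots> \<le> 4 * r" using r(1) by simp
      finally have "G \<le> 4 * r / (2 * r\<^sup>2)" unfolding G_def r(2)[symmetric] using r(1) by (intro divide_right_mono) auto
      also have "\<dots> = 2 / r" using r(1) by (simp add: power2_eq_square)
      also have "\<dots> \<le> 4 / (r + 1)" using r(1) by (simp add: field_simps)
      finally show ?thesis .
    qed
    then show ?thesis
      using Ncoll_prob_bound[OF N order_refl x(1,2) le G0 zero_less_one AE] unfolding r_def by linarith
  qed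
  ultimately show ?thesis unfolding m_def by blast
qed

text \<open>Raise \<open>y / m \<le> exp (y / m)\<close> to the power \<open>m\<close> and invert.
  This turns stretched exponential decay into polynomial decay of any order.\<close>

lemma exp_minus_le_power:
  fixes y :: real assumes "0 < y" "m \<ge> 1" shows "exp (- y) \<le> (real m / y) ^ m"
proof -
  have "y / m \<le> exp (y / m)" using exp_ge_add_one_self[of "y / m"] by linarith
  then have "(y / m) ^ m \<le> exp (y / m) ^ m" using assms by (intro power_mono) auto
  also have "\<dots> = exp y" using assms by (simp add: exp_of_nat_mult[symmetric])
  finally have "inverse (exp y) \<le> inverse ((y / m) ^ m)" using assms by (intro le_imp_inverse_le) auto
  then show ?thesis by (simp add: exp_minus power_divide inverse_eq_divide)
qed

text \<open>With \<open>M = (real N)\<^sup>2 * t\<close> and \<open>a = 1 / sqrt M\<close> the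
  growth factor of the exponential moment is just \<open>exp 2\<close>. Markov's inequality at level
  \<open>M powr (1/2 + \<zeta>)\<close> then leaves a bound of order
  \<open>exp (- c0 * M powr \<zeta>)\<close>.\<close>

lemma Ncoll_tail:
  fixes k :: nat
  assumes T: "0 < T" and z: "0 < \<zeta>" and k: "1 \<le> k"
  shows "\<exists>c::real. \<forall>t::real. 0 < t \<and> t \<le> T \<longrightarrow> (\<forall>N::nat. N \<ge> 1 \<longrightarrow>
    (\<forall>x1 \<in> Lambda N. \<forall>x2 \<in> Lambda N. x1 \<noteq> x2 \<longrightarrow>
      (let A = {w \<in> space (P_eps N). real (Ncoll w N x1 x2 t) \<ge> ((real N)\<^sup>2 * t) powr (1/2 + \<zeta>)} in
         A \<in> sets (completion (P_eps N)) \<and>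
         measure (completion (P_eps N)) A \<le> c * ((real N)\<^sup>2 * t) powr (- real k))))"
proof -
  \<comment> \<open>The wall constant in the worst case \<open>t = T\<close>:
    \<open>a * N = 1 / sqrt t\<close> is at least \<open>1 / sqrt T\<close> for every
    \<open>N\<close>.\<close>
  define B where "B = 1 / (1 - exp (- 2 / sqrt T))"
  define K where "K = 2 + 4 * B"
  \<comment> \<open>The 18 is 2 times 9, from \<open>exp th - 1 \<le> 2 * th\<close> and
    \<open>1 / 9 \<le> exp (- 2)\<close>.\<close>
  define c0 where "c0 = 1 / (18 * K)"
  \<comment> \<open>Large enough that \<open>m * \<zeta>\<close> reaches \<open>k\<close>.\<close>
  define m where "m = nat \<lceil>real k / \<zeta>\<rceil>"
  define C where "C = exp 2 * K * (real m / c0) ^ m"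
  have B: "0 < B" using T by (simp add: B_def)
  have K: "2 < K" using B by (simp add: K_def)
  have c0: "0 < c0" using K by (simp add: c0_def)
  have mz: "real k \<le> m * \<zeta>"
  proof -
    have "real k / \<zeta> \<le> real m" unfolding m_def by linarith
    then show ?thesis using z by (simp add: field_simps)
  qed
  have m: "1 \<le> m" using mz k z by (cases m) auto
  show ?thesis
  \<comment> \<open>The 1 in the maximum serves \<open>M < 1\<close>, where
    \<open>M powr (- real k)\<close> is at least 1 and any probability is below it.\<close>
  proof (intro exI[of _ "max 1 C"] allI impI ballI)
    fix t :: real and N :: nat and x1 x2
    assume t: "0 < t \<and> t \<le> T" and N: "1 \<le> N" and x: "x1 \<in> Lambda N" "x2 \<in> Lambda N" "x1 \<noteq> x2"
    interpret completion: prob_space "completion (P_eps N)"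
      by (intro prob_space.prob_space_completion prob_space_P_eps N)
    define M where "M = (real N)\<^sup>2 * t"
    have M0: "0 < M" using N t by (simp add: M_def)
    define A where "A = {w \<in> space (P_eps N). M powr (1/2 + \<zeta>) \<le> real (Ncoll w N x1 x2 t)}"
    define a where "a = 1 / sqrt M"
    define th where "th = c0 * a"
    have a0: "0 < a" using M0 by (simp add: a_def)
    have th0: "0 < th" using a0 c0 by (simp add: th_def)
    have AE: "AE w in P_eps N. w \<in> A \<longleftrightarrow> exp (th * M powr (1/2 + \<zeta>)) \<le> exp th ^ Ncoll w N x1 x2 t"
      using th0 by (intro AE_I2) (simp add: A_def exp_of_nat_mult[symmetric] mult.commute[of _ th])
    have meas: "A \<in> sets (completion (P_eps N))"
      by (rule Ncoll_event_measurable[OF N _ x(1,2) AE]) simp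
    have "measure (completion (P_eps N)) A \<le> max 1 C * M powr (- real k)"
    proof (cases "M < 1")
      case True
      have "1 = M powr 0" using M0 by simp
      also have "\<dots> \<le> M powr (- real k)" using M0 True by (intro powr_mono') auto
      finally have 1: "1 \<le> M powr (- real k)" .
      have "measure (completion (P_eps N)) A \<le> 1 * 1" by simp
      also have "\<dots> \<le> max 1 C * M powr (- real k)" using 1 by (intro mult_mono) auto
      finally show ?thesis .
    next
      case False
      then have sM: "1 \<le> sqrt M" by simp
      have a1: "a \<le> 1" using sM by (simp add: a_def)
      have a2: "2 * a\<^sup>2 * (real N)\<^sup>2 * t = 2"
        using M0 by (simp add: a_def power_divide M_def[symmetric] mult.assoc)
      have aN: "1 / sqrt T \<le> a * N"
      proof -
        have "a * N = 1 / sqrt t" using N t by (simp add: a_def M_def real_sqrt_mult)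
        then show ?thesis using t by (simp add: frac_le)
      qed
      have B1: "1 \<le> B * (1 - exp (- 2 * a * N))"
      proof -
        have "exp (- 2 * a * N) \<le> exp (- 2 / sqrt T)" using aN by simp
        moreover have "exp (- 2 / sqrt T) < 1" using T by simp
        ultimately show ?thesis unfolding B_def by (simp add: field_simps)
      qed
      have th1: "th \<le> 1"
      proof -
        have "c0 \<le> 1" using K by (simp add: c0_def)
        then show ?thesis unfolding th_def using a0 a1 c0 by (intro mult_le_one) auto
      qed
      have q: "(exp th - 1) * (2 + 4 * B) \<le> exp (- a) - exp (- 2 * a)"
      proof -
        have "exp th \<le> 1 + th + th\<^sup>2" using th0 th1 by (intro exp_bound) auto
        moreover have "th\<^sup>2 \<le> th" using th0 th1 by (simp add: power2_eq_square mult_left_le)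
        ultimately have "exp th - 1 \<le> 2 * th" by linarith
        then have "(exp th - 1) * K \<le> 2 * th * K" using K by (intro mult_right_mono) auto
        also have "\<dots> = a * (1 / 9)" using K by (simp add: th_def c0_def)
        also have "\<dots> \<le> a * exp (- 2 * a)"
        proof -
          have "exp 1 * exp 1 \<le> (3 * 3 :: real)" by (intro mult_mono exp_le) auto
          then have "exp 2 \<le> (9 :: real)" by (simp add: mult_exp_exp)
          then have "1 / 9 \<le> exp (- 2 :: real)" by (simp add: exp_minus field_simps)
          also have "\<dots> \<le> exp (- 2 * a)" using a1 by simp
          finally show ?thesis using a0 by (intro mult_left_mono) auto
        qed
        also have "\<dots> \<le> (exp a - 1) * exp (- 2 * a)"
        proof (rule mult_right_mono)
          show "a \<le> exp a - 1" using exp_ge_add_one_self[of a] by linarith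
        qed simp
        also have "\<dots> = exp (- a) - exp (- 2 * a)" by (simp add: left_diff_distrib mult_exp_exp)
        finally show ?thesis by (simp add: K_def)
      qed
      have le: "(\<integral>\<^sup>+w. weight (exp th) (inner_pairs N) n t x1 x2 w \<partial>P_eps N) \<le> ennreal (exp 2 * K)" for n
        using nn_integral_weight_exp_le[OF N _ x a0 a1 _ B1 _ q, of t n] t B th0 unfolding a2 K_def by simp
      have "measure (completion (P_eps N)) A \<le> exp 2 * K / exp (th * M powr (1/2 + \<zeta>))"
        by (rule Ncoll_prob_bound[OF N _ x(1,2) le _ _ AE]) (use K in auto)
      \<comment> \<open>The factor \<open>a = M powr (- 1/2)\<close> in \<open>th\<close> cancels
        the \<open>1/2\<close> in the exponent.\<close>
      also have "th * M powr (1/2 + \<zeta>) = c0 * M powr \<zeta>"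
        using M0 by (simp add: th_def a_def powr_add powr_half_sqrt)
      also have "exp 2 * K / exp (c0 * M powr \<zeta>) = exp 2 * K * exp (- (c0 * M powr \<zeta>))"
        by (simp add: exp_minus divide_inverse)
      also have "\<dots> \<le> exp 2 * K * (real m / (c0 * M powr \<zeta>)) ^ m"
        using K c0 M0 m by (intro mult_left_mono exp_minus_le_power) auto
      also have "\<dots> = C * M powr (- (m * \<zeta>))"
        using c0 M0 by (simp add: C_def power_divide power_mult_distrib powr_minus powr_powr[symmetric] powr_realpow field_simps)
      also have "\<dots> \<le> max 1 C * M powr (- real k)"
        using mz False by (intro mult_mono powr_mono) auto
      finally show ?thesis .
    qed
    with meas have "A \<in> sets (completion (P_eps N)) \<and> measure (completion (P_eps N)) A \<le> max 1 C * M powr (- real k)" ..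
    then show "let A = {w \<in> space (P_eps N). real (Ncoll w N x1 x2 t) \<ge> ((real N)\<^sup>2 * t) powr (1/2 + \<zeta>)} in
         A \<in> sets (completion (P_eps N)) \<and>
         measure (completion (P_eps N)) A \<le> max 1 C * ((real N)\<^sup>2 * t) powr (- real k)"
      unfolding A_def M_def Let_def .
  qed
qed

theorem theorem4p4:
  shows "(\<exists>c::real. \<forall>N::nat. N \<ge> 1 \<longrightarrow> (\<forall>t::real. t \<ge> 0 \<longrightarrow>
           (\<forall>x1 \<in> Lambda N. \<forall>x2 \<in> Lambda N. \<bar>x1 - x2\<bar> = 1 \<longrightarrow>
              (let A = {\<omega> \<in> space (P_eps N). ereal t \<le> tau \<omega> N x1 x2} in
                 A \<in> sets (completion (P_eps N)) \<and>
                 measure (completion (P_eps N)) A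
                   \<le> c / (sqrt ((real N)\<^sup>2 * t) + 1)))))
       \<and> (\<forall>T::real. T > 0 \<longrightarrow> (\<forall>\<zeta>::real. \<zeta> > 0 \<longrightarrow> (\<forall>k::nat. k \<ge> 1 \<longrightarrow>
           (\<exists>c::real. \<forall>t::real. 0 < t \<and> t \<le> T \<longrightarrow> (\<forall>N::nat. N \<ge> 1 \<longrightarrow>
              (\<forall>x1 \<in> Lambda N. \<forall>x2 \<in> Lambda N. x1 \<noteq> x2 \<longrightarrow>
                (let A = {\<omega> \<in> space (P_eps N).
                            real (Ncoll \<omega> N x1 x2 t) \<ge> ((real N)\<^sup>2 * t) powr (1/2 + \<zeta>)} in
                   A \<in> sets (completion (P_eps N)) \<and>
                   measure (completion (P_eps N)) A
                     \<le> c * ((real N)\<^sup>2 * t) powr (- real k))))))))"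
  using tau_bound Ncoll_tail unfolding Let_def by blast

end
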